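(* Consider the gap-observation bandit problem described in the context, with $K$ arms and horizon $T$, and let $M\in\mathbb N^*$ and $B^*>0$. Assume: (i) the observations $(X_{k,t})_{k\in[K],t\in[T]}$ are independent across arms and across time, satisfy $-X_{k,t}\in[0,1]$ and $\mathbb E X_{k,t}=-\Delta_k(t)$; (ii) there exist integers $1=\bar\tau_1<\dots<\bar\tau_M<\bar\tau_{M+1}=T+1$ such that for every $k\in[K]$, every $m\in\{1,\dots,M\}$ and all $t,t'\in[\bar\tau_m,\bar\tau_{m+1})\cap\mathbb N$, either $2^{-1/4}\le\Delta_k(t)/\Delta_k(t')\le2^{1/4}$ or $\Delta_k(t)\in[0,2(T^{-1/2}\lor B^* )]$. Then the expected regret of SelectiveBandits run with parameter $B^*$ satisfies, for any $c\ge16$, $$\mathbb E R^{(\mathrm{gap})}_T\le\{2^{3/2}+2^{1/2}c\log(2KT^3)\}\sqrt{KTM}+2KM+8T(B^*\lor T^{-1/2})+1.$$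
   Context: Setting (gap observations). There are $K$ arms $[K]$ and $T$ time steps. Arm $k$ at time $t$ has mean $\mu_k(t)=f_k(t/T)$ for an unknown $f_k$ on $[0,1]$; let $\mu^*(t)=\max_k\mu_k(t)$ and $\Delta_k(t)=\mu^*(t)-\mu_k(t)$. The observation for arm $k$ at time $t$ is $X_{k,t}=-\Delta_k(t)+\epsilon^{(k)}_t$. At each time $t$ the learner chooses an arm $k_t$ (based on past observations) and observes only $X_{k_t,t}$. The regret is $R^{(\mathrm{gap})}_T=-\mathbb E\sum_{t=1}^TX_{k_t,t}=\mathbb E\sum_{t=1}^T\Delta_{k_t}(t)$. Algorithm SelectiveBandits (parameter $B^*$). Time is divided into rounds $r=1,2,\dots$ with active sets $K_r\subset[K]$; if $K_r\ne\emptyset$, every arm of $K_r$ is pulled once in increasing order of index (the pull of $k$ in round $r$ yields $\tilde X_r(k)$); the algorithm stops when the budget $T$ is exhausted. The current episode started at round $\rho$ (initially $\rho=1$, and $K_1=[K]$). For rounds $r'<r$ let $T_k(r',r)=\sum_{j=r'}^{r-1}\mathbf 1\{k\in K_j\}$, $\hat\Delta_k(r',r)=-\frac{1}{T_k(r',r)}\sum_{j=r'}^{r-1}\tilde X_j(k)\mathbf 1\{k\in K_j\}$ (or $0$ if $T_k(r',r)=0$), and $\tilde\Delta_k(r',r)=\{\hat\Delta_k(r',r)-\sqrt{\log(2KT^3)/(2T_k(r',r))}-2(T^{-1/2}\lor B^* )\}\lor0$ (or $0$ if $T_k(r',r)=0$). For $r>1$, $K_r=\{k\in[K]:\tilde\Delta_k(\rho,r')=0\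 \text{for all}\ \rho\le r'\le r\}$. If $K_r=\emptyset$, no arm is pulled in round $r$, a new episode starts with $\rho=r$ (so all arms become active again, since no data from the new episode has been collected). *)

theory Defs
  imports "HOL-Probability.Probability"
begin

text \<open>Arms are [K] = {1..K}, time steps are {1..T}. Means mu_k(t) = f_k(t/T).\<close>

definition mean :: "real \<Rightarrow> (nat \<Rightarrow> real \<Rightarrow> real) \<Rightarrow> nat \<Rightarrow> nat \<Rightarrow> real" where
  "mean T f k t = f k (real t / T)"

definition gap :: "nat \<Rightarrow> nat \<Rightarrow> (nat \<Rightarrow> real \<Rightarrow> real) \<Rightarrow> nat \<Rightarrow> nat \<Rightarrow> real" where
  "gap K T f k t = Max ((\<lambda>j. mean (real T) f j t) ` {1..K}) - mean (real T) f k t"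

text \<open>History of the algorithm: Ks j is the active set of round j, S j the time of the
  first pull of round j.  The arm k of round j is pulled at time
  S j + card {i in Ks j. i < k} (arms pulled in increasing order), so the observation
  of arm k in round j is x k (pull time).  Here x k t is the (realised) value X_{k,t}.\<close>

definition pull_time :: "(nat \<Rightarrow> nat set) \<Rightarrow> (nat \<Rightarrow> nat) \<Rightarrow> nat \<Rightarrow> nat \<Rightarrow> nat" where
  "pull_time Ks S j k = S j + card {i \<in> Ks j. i < k}"

definition obs :: "(nat \<Rightarrow> nat \<Rightarrow> real) \<Rightarrow> (nat \<Rightarrow> nat set) \<Rightarrow> (nat \<Rightarrow> nat) \<Rightarrow> nat \<Rightarrow> nat \<Rightarrow> real" where
  "obs x Ks S j k = x k (pull_time Ks S j k)"

definition Tcount :: "(nat \<Rightarrow> nat set) \<Rightarrow> nat \<Rightarrow> nat \<Rightarrow> nat \<Rightarrow> nat" where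
  "Tcount Ks r' r k = card {j \<in> {r'..<r}. k \<in> Ks j}"

definition hatDelta :: "(nat \<Rightarrow> nat \<Rightarrow> real) \<Rightarrow> (nat \<Rightarrow> nat set) \<Rightarrow> (nat \<Rightarrow> nat) \<Rightarrow> nat \<Rightarrow> nat \<Rightarrow> nat \<Rightarrow> real" where
  "hatDelta x Ks S r' r k =
     (if Tcount Ks r' r k = 0 then 0
      else - (1 / real (Tcount Ks r' r k)) * (\<Sum>j \<in> {j \<in> {r'..<r}. k \<in> Ks j}. obs x Ks S j k))"

definition tildeDelta :: "nat \<Rightarrow> nat \<Rightarrow> real \<Rightarrow> (nat \<Rightarrow> nat \<Rightarrow> real) \<Rightarrow> (nat \<Rightarrow> nat set) \<Rightarrow> (nat \<Rightarrow> nat)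
    \<Rightarrow> nat \<Rightarrow> nat \<Rightarrow> nat \<Rightarrow> real" where
  "tildeDelta K T B x Ks S r' r k =
     (if Tcount Ks r' r k = 0 then 0
      else max (hatDelta x Ks S r' r k
                - sqrt (ln (2 * real K * real T ^ 3) / (2 * real (Tcount Ks r' r k)))
                - 2 * max (1 / sqrt (real T)) B) 0)"

definition active_set :: "nat \<Rightarrow> nat \<Rightarrow> real \<Rightarrow> (nat \<Rightarrow> nat \<Rightarrow> real) \<Rightarrow> (nat \<Rightarrow> nat set) \<Rightarrow> (nat \<Rightarrow> nat)
    \<Rightarrow> nat \<Rightarrow> nat \<Rightarrow> nat set" where
  "active_set K T B x Ks S rho n =
     {k \<in> {1..K}. \<forall>r' \<in> {rho..n}. tildeDelta K T B x Ks S rho r' k = 0}"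

text \<open>sb_state K T B x r = (rho, Ks, S): the state after rounds 1..r have been played:
  rho is the current episode start (used to compute K_{r+1}), Ks j (j \<le> r) the active sets,
  S j (j \<le> r+1) the starting times of the rounds.  Round 1 starts at time 1.\<close>
primrec sb_state :: "nat \<Rightarrow> nat \<Rightarrow> real \<Rightarrow> (nat \<Rightarrow> nat \<Rightarrow> real) \<Rightarrow> nat
    \<Rightarrow> nat \<times> (nat \<Rightarrow> nat set) \<times> (nat \<Rightarrow> nat)" where
  "sb_state K T B x 0 = (1, (\<lambda>_. {}), (\<lambda>_. 1))"
| "sb_state K T B x (Suc r) =
     (let (rho, Ks, S) = sb_state K T B x r;
          Kn = active_set K T B x Ks S rho (Suc r);
          rho' = (if Kn = {} then Suc r else rho)
      in (rho', Ks(Suc r := Kn), S(Suc (Suc r) := S (Suc r) + card Kn)))"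

definition sb_active :: "nat \<Rightarrow> nat \<Rightarrow> real \<Rightarrow> (nat \<Rightarrow> nat \<Rightarrow> real) \<Rightarrow> nat \<Rightarrow> nat set" where
  "sb_active K T B x j = fst (snd (sb_state K T B x j)) j"

definition sb_start :: "nat \<Rightarrow> nat \<Rightarrow> real \<Rightarrow> (nat \<Rightarrow> nat \<Rightarrow> real) \<Rightarrow> nat \<Rightarrow> nat" where
  "sb_start K T B x j = snd (snd (sb_state K T B x j)) j"

definition sb_arm :: "nat \<Rightarrow> nat \<Rightarrow> real \<Rightarrow> (nat \<Rightarrow> nat \<Rightarrow> real) \<Rightarrow> nat \<Rightarrow> nat" where
  "sb_arm K T B x t =
     (THE k. \<exists>j\<ge>1. k \<in> sb_active K T B x j \<and>
        sb_start K T B x j + card {i \<in> sb_active K T B x j. i < k} = t)"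

end

theory Submission
  imports Defs
begin

text \<open>
  Write \<open>b = max (1 / sqrt T) B\<close> and \<open>L = ln (2 K T\<^sup>3)\<close>. The arm chosen at time \<open>t\<close> only depends on earlier
  observations, so an Azuma--Hoeffding argument shows that, outside an event of probability at most
  \<open>1 / T\<close>, for every arm, every starting time and every \<open>n\<close>, the sum of the noise over the first \<open>n\<close> pulls of the
  arm after that time is at most \<open>sqrt (n L / 2)\<close> in absolute value. On this good event:

  \<^item> The \<open>N\<close> pulls of an arm within one episode cost at most \<open>2 b N + sqrt (2 L N) + 1\<close>, since the arm
    passed the test just before its last pull.
  \<^item> Distinct episodes start in distinct segments. An arm that is optimal at some time of a segment
    has gap at most \<open>2 b\<close> throughout it (the ratio condition fails for a zero gap), hence it cannot be
    eliminated by an episode whose data lie in that segment.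

  So there are at most \<open>K M\<close> pairs of an episode and an arm, and the Cauchy--Schwarz inequality bounds
  the regret by \<open>2 b T + sqrt (2 L K T M) + K M\<close>.
\<close>

section \<open>Rounds and pulls\<close>

text \<open>The rank strictly increases along \<open>A\<close>, hence is injective with values below
  \<open>card A\<close>; equal cardinalities give surjectivity. So the arms of a round fill
  consecutive times without gaps.\<close>

lemma bij_betw_rank:
  fixes A :: "nat set"
  assumes "finite A"
  shows "bij_betw (\<lambda>k. card {i \<in> A. i < k}) A {..<card A}"
proof -
  let ?h = "\<lambda>k. card {i \<in> A. i < k}"
  have less: "?h k < ?h l" if "k \<in> A" "k < l" for k l
    using assms that by (intro psubset_card_mono) auto
  have inj: "inj_on ?h A"
  proof (rule inj_onI)
    fix k l assume "k \<in> A" "l \<in> A" "?h k = ?h l"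
    then show "k = l" using less[of k l] less[of l k] by (cases k l rule: linorder_cases) auto
  qed
  have sub: "?h ` A \<subseteq> {..<card A}"
    using assms by (auto intro!: psubset_card_mono)
  have "?h ` A = {..<card A}"
    by (rule card_subset_eq[OF _ sub]) (simp_all add: card_image[OF inj])
  with inj show ?thesis by (simp add: bij_betw_def)
qed

text \<open>The statistic reads only the rounds from \<open>r'\<close> to \<open>r - 1\<close>. This
  serves both to replace a stored history by the completed one and to compare runs on observations
  that agree on the past.\<close>

lemma tildeDelta_cong:
  assumes "\<And>j. r' \<le> j \<Longrightarrow> j < r \<Longrightarrow> Ks j = Ks' j \<and> S j = S' j"
    and "\<And>j. r' \<le> j \<Longrightarrow> j < r \<Longrightarrow> k \<in> Ks j \<Longrightarrow>
      x k (pull_time Ks S j k) = y k (pull_time Ks S j k)"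
  shows "tildeDelta K T B x Ks S r' r k = tildeDelta K T B y Ks' S' r' r k"
proof -
  have sets: "{j \<in> {r'..<r}. k \<in> Ks j} = {j \<in> {r'..<r}. k \<in> Ks' j}"
    using assms(1) by auto
  have "obs x Ks S j k = obs y Ks' S' j k" if "j \<in> {j \<in> {r'..<r}. k \<in> Ks j}" for j
  proof -
    from that have "r' \<le> j" "j < r" "k \<in> Ks j" by auto
    from assms(1)[OF this(1,2)] assms(2)[OF this] show ?thesis
      by (simp add: obs_def pull_time_def)
  qed
  then have "(\<Sum>j \<in> {j \<in> {r'..<r}. k \<in> Ks' j}. obs x Ks S j k) =
      (\<Sum>j \<in> {j \<in> {r'..<r}. k \<in> Ks' j}. obs y Ks' S' j k)"
    using sets by (intro sum.cong) auto
  then show ?thesis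
    by (simp only: tildeDelta_def hatDelta_def Tcount_def sets)
qed

lemma tildeDelta_Tcount_0: "Tcount Ks r' r k = 0 \<Longrightarrow> tildeDelta K T B x Ks S r' r k = 0"
  by (simp add: tildeDelta_def)

lemma active_set_subset: "active_set K T B x Ks S p n \<subseteq> {1..K}"
  by (auto simp: active_set_def)

text \<open>The run on one fixed array of observations, continued for infinitely many rounds; the
  horizon enters only through the thresholds of the tests.\<close>

locale selective_bandits =
  fixes K T :: nat and B :: real and x :: "nat \<Rightarrow> nat \<Rightarrow> real"
  assumes K_pos: "K \<ge> 1"
begin

abbreviation A where "A \<equiv> sb_active K T B x"
abbreviation S where "S \<equiv> sb_start K T B x"
abbreviation arm where "arm \<equiv> sb_arm K T B x"

text \<open>The episode start in force once round \<open>r\<close> is complete: an empty round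
  \<open>r\<close> is already its own start.\<close>

definition rho :: "nat \<Rightarrow> nat" where
  "rho r = fst (sb_state K T B x r)"

section \<open>Recursions for the active sets, round starts and episode starts\<close>

lemma state_active: "j \<le> r \<Longrightarrow> fst (snd (sb_state K T B x r)) j = A j"
proof (induction r)
  case (Suc r)
  show ?case
  proof (cases "j = Suc r")
    case False
    then have "fst (snd (sb_state K T B x (Suc r))) j = fst (snd (sb_state K T B x r)) j"
      by (simp add: Let_def split: prod.split)
    with Suc False show ?thesis by simp
  qed (simp add: sb_active_def del: sb_state.simps)
qed (simp add: sb_active_def)

lemma state_start_Suc:
  "j \<noteq> Suc (Suc r) \<Longrightarrow>
    snd (snd (sb_state K T B x (Suc r))) j = snd (snd (sb_state K T B x r)) j"
  by (simp add: Let_def split: prod.split)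

text \<open>Entries are written once. The range reaches \<open>Suc r\<close> because completing
  round \<open>r\<close> fixes where the next round starts.\<close>

lemma state_start: "j \<le> Suc r \<Longrightarrow> snd (snd (sb_state K T B x r)) j = S j"
proof (induction r)
  case 0
  then consider "j = 0" | "j = Suc 0" by linarith
  then show ?case
    by cases (simp_all add: sb_start_def state_start_Suc del: sb_state.simps(2))
next
  case (Suc r)
  show ?case
  proof (cases "j = Suc (Suc r)")
    case True
    then show ?thesis
      using state_start_Suc[of j "Suc r"] by (simp add: sb_start_def del: sb_state.simps)
  next
    case False
    with Suc show ?thesis by (simp add: state_start_Suc del: sb_state.simps)
  qed
qed

lemma active_set_state:
  "active_set K T B x (fst (snd (sb_state K T B x r))) (snd (snd (sb_state K T B x r))) p (Suc r)
    = active_set K T B x A S p (Suc r)"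
proof -
  have "tildeDelta K T B x (fst (snd (sb_state K T B x r))) (snd (snd (sb_state K T B x r))) p r' k
    = tildeDelta K T B x A S p r' k" if "r' \<le> Suc r" for r' k
    using that by (intro tildeDelta_cong) (simp_all add: state_active state_start)
  then show ?thesis unfolding active_set_def by (intro Collect_cong) auto
qed

lemma A_Suc: "A (Suc r) = active_set K T B x A S (rho r) (Suc r)"
  by (simp add: active_set_state[symmetric] rho_def)
     (simp add: sb_active_def Let_def split: prod.split)

lemma A_0 [simp]: "A 0 = {}"
  by (simp add: sb_active_def)

lemma rho_0: "rho 0 = 1"
  by (simp add: rho_def)

lemma rho_Suc: "rho (Suc r) = (if A (Suc r) = {} then Suc r else rho r)"
  by (simp add: rho_def sb_active_def Let_def split: prod.split)

lemma S_0 [simp]: "S 0 = 1"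
  by (simp add: sb_start_def)

lemma S_Suc: "S (Suc j) = S j + card (A j)"
proof (cases j)
  case 0
  have "S (Suc 0) = 1" using state_start[of "Suc 0" 0] by simp
  with 0 show ?thesis by simp
next
  case (Suc r)
  have "S (Suc (Suc r)) = snd (snd (sb_state K T B x r)) (Suc r) + card (A (Suc r))"
    using state_start[of "Suc (Suc r)" "Suc r"]
    by (simp add: sb_active_def Let_def split: prod.splits)
  also have "snd (snd (sb_state K T B x r)) (Suc r) = S (Suc r)"
    by (rule state_start) simp
  finally show ?thesis using Suc by simp
qed

lemma A_subset: "A j \<subseteq> {1..K}"
  by (cases j) (simp_all only: A_0 A_Suc active_set_subset empty_subsetI)

lemma finite_A [simp]: "finite (A j)"
  using A_subset finite_subset by blast

lemma S_mono: "i \<le> j \<Longrightarrow> S i \<le> S j"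
  by (rule lift_Suc_mono_le[of S]) (simp_all add: S_Suc)

lemma S_ge_1: "1 \<le> S j"
  using S_mono[of 0 j] by simp

lemma rho_mono: "i \<le> j \<Longrightarrow> rho i \<le> rho j"
proof -
  have "rho r \<le> max 1 r" for r
    by (induction r) (auto simp: rho_0 rho_Suc)
  then have "rho r \<le> rho (Suc r)" for r
    using le_trans[of "rho r" "max 1 r" "Suc r"] by (simp add: rho_Suc)
  then show "i \<le> j \<Longrightarrow> rho i \<le> rho j" by (rule lift_Suc_mono_le)
qed

lemma rho_ge_1: "1 \<le> rho j"
  using rho_mono[of 0 j] by (simp add: rho_0)

lemma rho_le: "1 \<le> j \<Longrightarrow> rho j \<le> j"
  by (induction j rule: dec_induct) (auto simp: rho_Suc rho_0)

lemma rho_rho: "rho (rho j) = rho j"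
  by (induction j) (auto simp: rho_Suc rho_0)

text \<open>A restart is recorded at the empty round itself; the pulls of the new episode begin one
  round later.\<close>

lemma A_rho: "rho j \<noteq> 1 \<Longrightarrow> A (rho j) = {}"
  by (induction j) (auto simp: rho_Suc rho_0 split: if_splits)

text \<open>The new episode has no data yet, so all statistics take their default value 0 and every
  test passes. The case \<open>j = 0\<close> is the initial round.\<close>

lemma A_after_empty:
  assumes "A j = {}"
  shows "A (Suc j) = {1..K}"
proof -
  have "Tcount A (rho j) r' k = 0" if "r' \<in> {rho j..Suc j}" for r' k
  proof (cases j)
    case 0
    then show ?thesis using that by (simp add: Tcount_def rho_0)
  next
    case (Suc i)
    then have "rho j = j" using assms by (simp add: rho_Suc)
    with that assms have "{i \<in> {rho j..<r'}. k \<in> A i} = {}"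
      by (auto simp: less_Suc_eq_le) (metis empty_iff le_antisym le_trans less_Suc_eq_le order_less_le_trans)
    then show ?thesis by (simp add: Tcount_def)
  qed
  then show ?thesis
    by (auto simp: A_Suc active_set_def tildeDelta_Tcount_0)
qed

text \<open>An empty round is followed by a full one, so two consecutive rounds consume at least one
  time step.\<close>

lemma S_unbounded: "n < S (Suc (2 * n))"
proof (induction n)
  case 0
  show ?case using S_ge_1[of 1] by simp
next
  case (Suc n)
  have "S (Suc (2 * n)) < S (Suc (Suc (Suc (2 * n))))"
  proof (cases "A (Suc (2 * n)) = {}")
    case True
    then have "A (Suc (Suc (2 * n))) = {1..K}" by (rule A_after_empty)
    then show ?thesis using K_pos by (simp add: S_Suc)
  next
    case False
    then show ?thesis by (simp add: S_Suc card_gt_0_iff)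
  qed
  with Suc show ?case by simp
qed

section \<open>Rounds as consecutive intervals of time\<close>

definition round :: "nat \<Rightarrow> nat" where
  "round t = (LEAST j. t < S (Suc j))"

lemma round_bounds:
  assumes "1 \<le> t"
  shows "S (round t) \<le> t" "t < S (Suc (round t))"
proof -
  show *: "t < S (Suc (round t))"
    unfolding round_def using S_unbounded by (rule LeastI)
  show "S (round t) \<le> t"
  proof (cases "round t")
    case 0
    with assms show ?thesis by simp
  next
    case (Suc i)
    then have "\<not> t < S (Suc i)"
      unfolding round_def by (metis lessI not_less_Least)
    with Suc show ?thesis by simp
  qed
qed

lemma round_eqI:
  assumes "S j \<le> t" "t < S (Suc j)"
  shows "round t = j"
proof -
  have t: "1 \<le> t" using assms S_ge_1[of j] by linarith
  have "\<not> Suc (round t) \<le> j" using S_mono[of "Suc (round t)" j] assms round_bounds[OF t] by linarith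
  moreover have "\<not> Suc j \<le> round t" using S_mono[of "Suc j" "round t"] assms round_bounds[OF t] by linarith
  ultimately show ?thesis by linarith
qed

lemma pull_time_bounds:
  assumes "k \<in> A j"
  shows "S j \<le> pull_time A S j k" "pull_time A S j k < S (Suc j)"
  using bij_betwE[OF bij_betw_rank[OF finite_A]] assms
  by (auto simp: pull_time_def S_Suc)

lemma round_pull_time: "k \<in> A j \<Longrightarrow> round (pull_time A S j k) = j"
  by (intro round_eqI pull_time_bounds)

lemma arm_pull_time:
  assumes k: "k \<in> A j"
  shows "arm (pull_time A S j k) = k"
proof -
  let ?t = "pull_time A S j k"
  have "arm ?t = (THE k'. \<exists>j'\<ge>1. k' \<in> A j' \<and> pull_time A S j' k' = ?t)"
    by (simp add: sb_arm_def pull_time_def)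
  also have "\<dots> = k"
  proof (rule the_equality)
    have "j \<ge> 1" using k by (cases j) auto
    with k show "\<exists>j'\<ge>1. k \<in> A j' \<and> pull_time A S j' k = ?t" by blast
  next
    fix k' assume "\<exists>j'\<ge>1. k' \<in> A j' \<and> pull_time A S j' k' = ?t"
    then obtain j' where j': "k' \<in> A j'" "pull_time A S j' k' = ?t" by blast
    \<comment> \<open>The time determines the round; within a round the rank determines the
      arm.\<close>
    then have "j' = j" using round_pull_time k by metis
    with j' k show "k' = k"
      using bij_betw_imp_inj_on[OF bij_betw_rank[OF finite_A[of j]]]
      by (auto simp: pull_time_def inj_on_def)
  qed
  finally show ?thesis .
qed

lemma
  assumes t: "1 \<le> t"
  shows arm_in_A: "arm t \<in> A (round t)"
    and pull_time_arm: "pull_time A S (round t) (arm t) = t"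
proof -
  let ?j = "round t"
  have "t - S ?j \<in> {..<card (A ?j)}"
    using round_bounds[OF t] by (auto simp: S_Suc)
  then obtain k where k: "k \<in> A ?j" "t - S ?j = card {i \<in> A ?j. i < k}"
    using bij_betw_imp_surj_on[OF bij_betw_rank[OF finite_A[of ?j]]] by blast
  then have "pull_time A S ?j k = t"
    using round_bounds[OF t] by (simp add: pull_time_def)
  moreover from this have "arm t = k" using arm_pull_time[OF k(1)] by simp
  ultimately show "arm t \<in> A ?j" "pull_time A S ?j (arm t) = t" using k by simp_all
qed

lemma arm_range: "1 \<le> t \<Longrightarrow> arm t \<in> {1..K}"
  using arm_in_A A_subset by blast

section \<open>The elimination test in terms of pull times\<close>

definition pulls :: "nat \<Rightarrow> nat \<Rightarrow> nat \<Rightarrow> nat set" where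
  "pulls k s u = {t \<in> {s..<u}. arm t = k}"

lemma finite_pulls [simp]: "finite (pulls k s u)"
  by (simp add: pulls_def)

lemma le_round_iff:
  assumes "1 \<le> t"
  shows "p \<le> round t \<longleftrightarrow> S p \<le> t"
proof
  assume "p \<le> round t"
  then show "S p \<le> t" using S_mono[of p "round t"] round_bounds[OF assms] by linarith
next
  assume "S p \<le> t"
  then have "\<not> Suc (round t) \<le> p"
    using S_mono[of "Suc (round t)" p] round_bounds[OF assms] by linarith
  then show "p \<le> round t" by simp
qed

text \<open>The inverse map is \<open>round\<close>, since an arm is pulled at most once per round.
  Sums over rounds thereby become sums over a time window.\<close>

lemma bij_betw_pull_time:
  "bij_betw (\<lambda>j. pull_time A S j k) {j \<in> {p..<r}. k \<in> A j} (pulls k (S p) (S r))"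
proof (rule bij_betw_byWitness[where f' = round])
  show "\<forall>j\<in>{j \<in> {p..<r}. k \<in> A j}. round (pull_time A S j k) = j"
    by (simp add: round_pull_time)
  have t1: "1 \<le> t" if "t \<in> pulls k (S p) (S r)" for t
    using that S_ge_1[of p] by (auto simp: pulls_def)
  show "\<forall>t\<in>pulls k (S p) (S r). pull_time A S (round t) k = t"
    using t1 pull_time_arm by (auto simp: pulls_def)
  show "(\<lambda>j. pull_time A S j k) ` {j \<in> {p..<r}. k \<in> A j} \<subseteq> pulls k (S p) (S r)"
  proof clarsimp
    fix j assume j: "p \<le> j" "j < r" "k \<in> A j"
    show "pull_time A S j k \<in> pulls k (S p) (S r)"
      using pull_time_bounds[OF j(3)] S_mono[of p j] S_mono[of "Suc j" r] j arm_pull_time[OF j(3)]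
      by (simp add: pulls_def)
  qed
  show "round ` pulls k (S p) (S r) \<subseteq> {j \<in> {p..<r}. k \<in> A j}"
  proof clarsimp
    fix t assume t: "t \<in> pulls k (S p) (S r)"
    then show "p \<le> round t \<and> round t < r \<and> k \<in> A (round t)"
      using le_round_iff[OF t1[OF t]] arm_in_A[OF t1[OF t]]
      by (auto simp: pulls_def) (metis leD le_less_linear)
  qed
qed

lemma Tcount_eq: "Tcount A p r k = card (pulls k (S p) (S r))"
  unfolding Tcount_def by (rule bij_betw_same_card[OF bij_betw_pull_time])

lemma sum_obs_eq:
  "(\<Sum>j\<in>{j \<in> {p..<r}. k \<in> A j}. obs x A S j k) = (\<Sum>t\<in>pulls k (S p) (S r). x k t)"
  unfolding obs_def by (rule sum.reindex_bij_betw[OF bij_betw_pull_time])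

text \<open>The test multiplied by the number of pulls, which is the shape of the concentration
  bound. For \<open>n = 0\<close> both sides hold: the statistic is 0 by default and the sum is
  empty.\<close>

lemma tildeDelta_eq_0_iff:
  fixes k p r :: nat
  defines "n \<equiv> card (pulls k (S p) (S r))"
  shows "tildeDelta K T B x A S p r k = 0 \<longleftrightarrow>
    - (\<Sum>t\<in>pulls k (S p) (S r). x k t)
      \<le> sqrt (real n * ln (2 * real K * real T ^ 3) / 2) + 2 * max (1 / sqrt (real T)) B * real n"
proof (cases "n = 0")
  case True
  then have "pulls k (S p) (S r) = {}" by (simp add: n_def)
  then show ?thesis using True by (simp add: tildeDelta_def Tcount_eq n_def)
next
  case False
  define L where "L = ln (2 * real K * real T ^ 3)"
  define m where "m = real n"
  have m: "m > 0" using False by (simp add: m_def)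
  define a where "a = sqrt (L / (2 * m))"
  define d where "d = 2 * max (1 / sqrt (real T)) B"
  define z where "z = (\<Sum>t\<in>pulls k (S p) (S r). x k t)"
  have "m * L / 2 = m\<^sup>2 * (L / (2 * m))"
    using m by (simp add: power2_eq_square)
  then have sq: "sqrt (m * L / 2) = m * a"
    using m by (simp only: a_def real_sqrt_mult) simp
  have "tildeDelta K T B x A S p r k = max (- (1 / m) * z - a - d) 0"
    using False unfolding tildeDelta_def hatDelta_def sum_obs_eq Tcount_eq n_def[symmetric]
    by (simp add: z_def m_def a_def d_def L_def)
  also have "\<dots> = 0 \<longleftrightarrow> - (1 / m) * z - a - d \<le> 0"
    by (simp add: max_def)
  also have "\<dots> \<longleftrightarrow> - z \<le> m * a + d * m"
    using m by (simp add: field_simps)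
  finally show ?thesis unfolding L_def[symmetric] m_def[symmetric] sq d_def z_def .
qed

text \<open>Episodes are labelled by a time rather than a round, so that the label can be a starting
  time in the concentration bound and can be located in a segment.\<close>

definition episode_start :: "nat \<Rightarrow> nat" where
  "episode_start t = S (rho (round t))"

lemma round_ge_1: "1 \<le> t \<Longrightarrow> 1 \<le> round t"
  using arm_in_A[of t] by (cases "round t") auto

lemma episode_start_bounds:
  assumes "1 \<le> t"
  shows "1 \<le> episode_start t" "episode_start t \<le> t"
proof -
  show "1 \<le> episode_start t" by (simp add: episode_start_def S_ge_1 del: One_nat_def)
  have "S (rho (round t)) \<le> S (round t)"
    by (intro S_mono rho_le round_ge_1 assms)
  then show "episode_start t \<le> t"
    using round_bounds(1)[OF assms] by (simp add: episode_start_def)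
qed

lemma episode_start_range: "t \<in> {1..n} \<Longrightarrow> episode_start t \<in> {1..n}"
  using episode_start_bounds[of t] by simp

lemma round_mono: "1 \<le> t \<Longrightarrow> t \<le> t' \<Longrightarrow> round t \<le> round t'"
  using le_round_iff[of t' "round t"] round_bounds(1)[of t] by simp

text \<open>All selected times but the last are pulls before the last one, of which there are fewer
  than \<open>n\<close>. Membership of \<open>t\<close> is decided before the observation at
  \<open>t\<close> is seen, and the size bound is deterministic, as Azuma-Hoeffding
  requires.\<close>

lemma card_first_pulls_le:
  "card {t \<in> {1..m}. s \<le> t \<and> arm t = k \<and> card (pulls k s t) < n} \<le> n"
proof (cases "{t \<in> {1..m}. s \<le> t \<and> arm t = k \<and> card (pulls k s t) < n} = {}")
  case True
  then show ?thesis by (simp only: card.empty)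
next
  case False
  define H where "H = {t \<in> {1..m}. s \<le> t \<and> arm t = k \<and> card (pulls k s t) < n}"
  have fin: "finite H" and ne: "H \<noteq> {}" using False by (simp_all add: H_def)
  define u where "u = Max H"
  have u: "u \<in> H" using fin ne by (simp add: u_def)
  have "H - {u} \<subseteq> pulls k s u"
  proof
    fix t assume t: "t \<in> H - {u}"
    then have "t \<le> u" using fin by (simp add: u_def)
    with t show "t \<in> pulls k s u" by (simp add: H_def pulls_def)
  qed
  then have "card (H - {u}) \<le> card (pulls k s u)" by (rule card_mono[OF finite_pulls])
  moreover have "card (pulls k s u) < n" using u by (simp add: H_def)
  ultimately have "card H \<le> n" using card_Diff_singleton[OF u] by linarith
  then show ?thesis by (simp only: H_def)
qed

text \<open>With \<open>n\<close> the actual number of pulls, the selection is the whole window; a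
  union over \<open>n\<close> thus controls windows with a random end \<open>u\<close>.\<close>

lemma first_pulls_eq:
  assumes "1 \<le> s" "u \<le> m + 1"
  shows "{t \<in> {1..m}. s \<le> t \<and> arm t = k \<and> card (pulls k s t) < card (pulls k s u)} = pulls k s u"
proof (rule set_eqI, rule iffI)
  fix t assume t: "t \<in> {t \<in> {1..m}. s \<le> t \<and> arm t = k \<and> card (pulls k s t) < card (pulls k s u)}"
  have "\<not> u \<le> t"
  proof
    assume "u \<le> t"
    then have "pulls k s u \<subseteq> pulls k s t" by (auto simp: pulls_def)
    then have "card (pulls k s u) \<le> card (pulls k s t)" by (rule card_mono[OF finite_pulls])
    with t show False by simp
  qed
  with t show "t \<in> pulls k s u" by (simp add: pulls_def)
next
  fix t assume t: "t \<in> pulls k s u"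
  then have "pulls k s t \<subset> pulls k s u" by (auto simp: pulls_def)
  then have "card (pulls k s t) < card (pulls k s u)" by (rule psubset_card_mono[OF finite_pulls])
  with t assms show "t \<in> {t \<in> {1..m}. s \<le> t \<and> arm t = k \<and> card (pulls k s t) < card (pulls k s u)}"
    by (simp add: pulls_def)
qed

end

section \<open>Regret on the concentration event\<close>

text \<open>One realisation on the good event. All starts and ends are covered because episode
  boundaries depend on the observations; \<open>u\<close> reaches \<open>T + 1\<close> since windows
  are half open.\<close>

locale concentrated_bandits = selective_bandits +
  fixes g :: "nat \<Rightarrow> nat \<Rightarrow> real" and L b :: real
  defines "L \<equiv> ln (2 * real K * real T ^ 3)" and "b \<equiv> max (1 / sqrt (real T)) B"
  assumes T_pos: "1 \<le> T"
    and gap_bounds: "\<And>k t. k \<in> {1..K} \<Longrightarrow> t \<in> {1..T} \<Longrightarrow> 0 \<le> g k t \<and> g k t \<le> 1"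
    and concentration: "\<And>k s u. k \<in> {1..K} \<Longrightarrow> s \<in> {1..T} \<Longrightarrow> u \<le> T + 1 \<Longrightarrow>
      \<bar>\<Sum>t\<in>pulls k s u. x k t + g k t\<bar> \<le> sqrt (real (card (pulls k s u)) * L / 2)"
begin

lemma L_nonneg: "0 \<le> L"
proof -
  have "1 \<le> real K" "1 \<le> real T ^ 3" using K_pos T_pos by (auto simp: one_le_power)
  then have "1 * 1 \<le> real K * real T ^ 3" by (intro mult_mono) auto
  then have "1 \<le> 2 * real K * real T ^ 3" by linarith
  then show ?thesis unfolding L_def by (rule ln_ge_zero)
qed

lemma b_pos: "0 < b"
  using T_pos by (simp add: b_def less_max_iff_disj)

text \<open>Bounds the number of episodes by the number of segments. A second start in the same
  segment needs an empty round, but an arm with small gap there passes all tests of the episode that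
  this round would end.\<close>

lemma episode_start_inj_segment:
  assumes mono: "\<And>t t'. t \<in> {1..T} \<Longrightarrow> t' \<in> {1..T} \<Longrightarrow> t \<le> t' \<Longrightarrow> seg t \<le> (seg t' :: nat)"
    and small: "\<And>s. s \<in> {1..T} \<Longrightarrow> \<exists>k\<in>{1..K}. \<forall>t\<in>{1..T}. seg t = seg s \<longrightarrow> g k t \<le> 2 * b"
  shows "inj_on seg (episode_start ` {1..T})"
proof -
  have neq: "seg s \<noteq> seg s'"
    if s: "s \<in> episode_start ` {1..T}" and s': "s' \<in> episode_start ` {1..T}" and less: "s < s'"
    for s s'
  proof
    assume eq: "seg s = seg s'"
    have ran: "s \<in> {1..T}" "s' \<in> {1..T}"
      using s s' episode_start_range by auto
    obtain i j where ij: "s = S (rho i)" "s' = S (rho j)"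
      using s s' by (auto simp: episode_start_def)
    define p p' where "p = rho i" and "p' = rho j"
    have "p < p'" using less S_mono[of p' p] ij by (cases "p < p'") (auto simp: p_def p'_def)
    moreover have "1 \<le> p" using rho_ge_1 p_def by simp
    ultimately have "p' \<noteq> 1" by simp
    then have empty: "A p' = {}" unfolding p'_def by (rule A_rho)
    obtain q where q: "p' = Suc q" using \<open>p < p'\<close> by (cases p') auto
    \<comment> \<open>The start of the episode that round \<open>p'\<close> ends. It is not before
      \<open>p\<close>, so its data lie between \<open>s\<close> and \<open>s'\<close>, inside one
      segment.\<close>
    define e where "e = rho q"
    have e: "p \<le> e" using rho_mono[of p q] \<open>p < p'\<close> q by (simp add: e_def p_def rho_rho)
    obtain k where k: "k \<in> {1..K}" and gk: "\<And>t. t \<in> {1..T} \<Longrightarrow> seg t = seg s \<Longrightarrow> g k t \<le> 2 * b"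
      using small[OF ran(1)] by blast
    have "tildeDelta K T B x A S e r k = 0" if r: "r \<in> {e..p'}" for r
    proof -
      let ?J = "pulls k (S e) (S r)"
      have Sb: "s \<le> S e" "S e \<le> S r" "S r \<le> s'"
        using S_mono[OF e] S_mono[of e r] S_mono[of r p'] r by (auto simp: ij p_def p'_def)
      have "g k t \<le> 2 * b" if t: "t \<in> ?J" for t
      proof -
        have "s \<le> t" "t \<le> s'" using t Sb by (auto simp: pulls_def)
        then have "t \<in> {1..T}" "seg s \<le> seg t" "seg t \<le> seg s'"
          using ran by (auto intro!: mono)
        with eq show ?thesis by (intro gk) auto
      qed
      then have "(\<Sum>t\<in>?J. g k t) \<le> real (card ?J) * (2 * b)"
        by (rule sum_bounded_above)
      moreover have "\<bar>\<Sum>t\<in>?J. x k t + g k t\<bar> \<le> sqrt (real (card ?J) * L / 2)"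
        using Sb ran by (intro concentration k) auto
      ultimately have "- (\<Sum>t\<in>?J. x k t) \<le> sqrt (real (card ?J) * L / 2) + 2 * b * real (card ?J)"
        by (simp add: sum.distrib mult_ac)
      then show ?thesis by (simp add: tildeDelta_eq_0_iff L_def b_def)
    qed
    then have "k \<in> A p'" using k by (simp add: q A_Suc active_set_def e_def)
    with empty show False by simp
  qed
  then show ?thesis by (intro inj_onI) (metis linorder_neqE_nat)
qed

text \<open>The test admitting \<open>k\<close> to the round of its last pull controls all earlier
  pulls of the episode; the last pull is charged the trivial bound 1.\<close>

lemma episode_arm_regret:
  fixes k s :: nat
  assumes k: "k \<in> {1..K}"
  defines "I \<equiv> {t \<in> {1..T}. episode_start t = s \<and> arm t = k}"
  shows "(\<Sum>t\<in>I. g k t) \<le> 2 * b * real (card I) + sqrt (2 * L * real (card I)) + 1"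
proof (cases "I = {}")
  case True
  then show ?thesis by simp
next
  case False
  have finI: "finite I" by (simp add: I_def)
  define u where "u = Max I"
  define r where "r = round u"
  define p where "p = rho r"
  let ?J = "pulls k (S p) (S r)"
  have uI: "u \<in> I" using finI False by (simp add: u_def)
  then have u: "1 \<le> u" "u \<le> T" "S p = s" "arm u = k"
    by (auto simp: I_def episode_start_def p_def r_def)
  have kA: "k \<in> A r" using arm_in_A[OF u(1)] u r_def by simp
  obtain q where q: "r = Suc q" using round_ge_1[OF u(1)] by (cases r) (auto simp: r_def)
  have pq: "p = rho q" using kA by (auto simp: p_def q rho_Suc)
  have p_le: "p \<le> r" unfolding p_def r_def by (intro rho_le round_ge_1 u)
  have Sr: "S r \<le> u" unfolding r_def by (rule round_bounds[OF u(1)])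
  have s1: "1 \<le> S p" "S p \<le> u"
    using S_ge_1 S_mono[OF p_le] Sr by auto
  have "tildeDelta K T B x A S p r k = 0"
    using kA p_le unfolding q A_Suc pq by (simp add: active_set_def)
  then have "- (\<Sum>t\<in>?J. x k t) \<le> sqrt (real (card ?J) * L / 2) + 2 * b * real (card ?J)"
    by (simp add: tildeDelta_eq_0_iff L_def b_def)
  moreover have "\<bar>\<Sum>t\<in>?J. x k t + g k t\<bar> \<le> sqrt (real (card ?J) * L / 2)"
    using Sr s1 u by (intro concentration k) auto
  \<comment> \<open>The deviation is paid twice: in the threshold of the test and in passing from
    observations to gaps.\<close>
  ultimately have J: "(\<Sum>t\<in>?J. g k t) \<le> 2 * sqrt (real (card ?J) * L / 2) + 2 * b * real (card ?J)"
    by (simp add: sum.distrib)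
  have "2 * sqrt (real (card ?J) * L / 2) = sqrt (2\<^sup>2 * (real (card ?J) * L / 2))"
    by (simp only: real_sqrt_mult) simp
  also have "\<dots> = sqrt (2 * L * real (card ?J))" by (simp add: mult_ac)
  finally have sq: "2 * sqrt (real (card ?J) * L / 2) = sqrt (2 * L * real (card ?J))" .
  have JI: "?J \<subseteq> I"
  proof
    fix t assume t: "t \<in> ?J"
    then have t': "1 \<le> t" "t \<le> u" "S p \<le> t" "t < S r" "arm t = k"
      using s1 Sr by (auto simp: pulls_def)
    have "p \<le> round t" "round t \<le> r"
      using le_round_iff[OF t'(1)] t' round_mono[OF t'(1,2)] by (auto simp: r_def)
    then have "rho (round t) = p"
      using rho_mono[of p "round t"] rho_mono[of "round t" r] by (simp add: p_def rho_rho)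
    then show "t \<in> I" using t' u by (simp add: I_def episode_start_def)
  qed
  \<comment> \<open>A pull in \<open>I\<close> from time \<open>S r\<close> on lies in round
    \<open>r\<close>, where \<open>k\<close> is pulled only once, so it is \<open>u\<close>.\<close>
  have IJ: "I \<subseteq> insert u ?J"
  proof
    fix t assume t: "t \<in> I"
    then have t': "1 \<le> t" "episode_start t = s" "arm t = k" "t \<le> u"
      using finI by (auto simp: I_def u_def)
    have "t = u" if "\<not> t < S r"
    proof -
      have "round t = r"
        using le_round_iff[OF t'(1), of r] that round_mono[OF t'(1,4)] by (simp add: r_def)
      then show "t = u"
        using pull_time_arm[OF t'(1)] pull_time_arm[OF u(1)] t' u by (simp add: r_def)
    qed
    moreover have "S p \<le> t" using episode_start_bounds[OF t'(1)] t' u by simp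
    ultimately show "t \<in> insert u ?J" using t' by (auto simp: pulls_def)
  qed
  have nonneg: "0 \<le> g k t" if "t \<in> insert u ?J" for t
    using gap_bounds[OF k, of t] that JI uI by (auto simp: I_def)
  have uJ: "u \<notin> ?J" using Sr by (auto simp: pulls_def)
  have "(\<Sum>t\<in>I. g k t) \<le> (\<Sum>t\<in>insert u ?J. g k t)"
    using IJ nonneg by (intro sum_mono2) auto
  also have "\<dots> = g k u + (\<Sum>t\<in>?J. g k t)" using uJ by simp
  also have "\<dots> \<le> 1 + (sqrt (2 * L * real (card ?J)) + 2 * b * real (card ?J))"
  proof (rule add_mono)
    show "g k u \<le> 1" using gap_bounds[OF k, of u] u by simp
    show "(\<Sum>t\<in>?J. g k t) \<le> sqrt (2 * L * real (card ?J)) + 2 * b * real (card ?J)"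
      using J by (simp only: sq)
  qed
  also have "\<dots> \<le> 1 + (sqrt (2 * L * real (card I)) + 2 * b * real (card I))"
    using L_nonneg b_pos card_mono[OF finI JI]
    by (intro add_mono mult_left_mono real_sqrt_le_mono) auto
  finally show ?thesis by simp
qed

text \<open>Sum over pairs of an episode and an arm: injectivity into the segments leaves at most
  \<open>K * m\<close> pairs, whose pull counts add up to \<open>T\<close>.\<close>

theorem regret_bound:
  assumes seg: "\<And>t. t \<in> {1..T} \<Longrightarrow> seg t \<in> {1..m}"
    and mono: "\<And>t t'. t \<in> {1..T} \<Longrightarrow> t' \<in> {1..T} \<Longrightarrow> t \<le> t' \<Longrightarrow> seg t \<le> (seg t' :: nat)"
    and small: "\<And>s. s \<in> {1..T} \<Longrightarrow> \<exists>k\<in>{1..K}. \<forall>t\<in>{1..T}. seg t = seg s \<longrightarrow> g k t \<le> 2 * b"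
  shows "(\<Sum>t\<in>{1..T}. g (arm t) t)
    \<le> 2 * b * real T + sqrt (2 * L) * sqrt (real K * real T * real m) + real K * real m"
proof -
  let ?E = "episode_start ` {1..T}"
  let ?P = "?E \<times> {1..K}"
  let ?h = "\<lambda>t. (episode_start t, arm t)"
  define I where "I q = {t \<in> {1..T}. ?h t = q}" for q
  have sub: "?h ` {1..T} \<subseteq> ?P" using arm_range by auto
  have E_seg: "seg ` ?E \<subseteq> {1..m}"
    using seg episode_start_range by blast
  have "card ?E \<le> m"
    using card_inj_on_le[OF episode_start_inj_segment[of seg, OF mono small] E_seg] by simp
  then have "card ?P \<le> m * K" by (simp add: card_cartesian_product)
  then have cardP: "real (card ?P) \<le> real K * real m"
    by (metis mult.commute of_nat_le_iff of_nat_mult)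
  have cardI: "(\<Sum>q\<in>?P. real (card (I q))) = real T"
    using sum.group[OF _ _ sub, of "\<lambda>_. 1 :: real"] by (simp add: I_def)
  have "(\<Sum>t\<in>{1..T}. g (arm t) t) = (\<Sum>q\<in>?P. \<Sum>t\<in>I q. g (arm t) t)"
    unfolding I_def by (rule sum.group[OF _ _ sub, symmetric]) auto
  also have "\<dots> \<le> (\<Sum>q\<in>?P. 2 * b * real (card (I q)) + sqrt (2 * L * real (card (I q))) + 1)"
  proof (rule sum_mono)
    fix q assume "q \<in> ?P"
    then obtain s k where q: "q = (s, k)" "k \<in> {1..K}" by auto
    have "(\<Sum>t\<in>I q. g (arm t) t) = (\<Sum>t\<in>I q. g k t)"
      by (rule sum.cong) (auto simp: I_def q)
    then show "(\<Sum>t\<in>I q. g (arm t) t)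
        \<le> 2 * b * real (card (I q)) + sqrt (2 * L * real (card (I q))) + 1"
      using episode_arm_regret[OF q(2), of s] by (simp add: I_def q)
  qed
  also have "\<dots> = 2 * b * real T + (\<Sum>q\<in>?P. sqrt (2 * L * real (card (I q)))) + real (card ?P)"
    by (simp add: sum.distrib sum_distrib_left[symmetric] cardI del: One_nat_def)
  also have "(\<Sum>q\<in>?P. sqrt (2 * L * real (card (I q)))) \<le> sqrt (2 * L) * sqrt (real K * real T * real m)"
  proof -
    \<comment> \<open>Cauchy-Schwarz against the constant 1 leaves the number of pairs times the
      total count.\<close>
    have "(\<Sum>q\<in>?P. 1 * sqrt (2 * L * real (card (I q))))\<^sup>2
      \<le> (\<Sum>q\<in>?P. 1\<^sup>2) * (\<Sum>q\<in>?P. (sqrt (2 * L * real (card (I q))))\<^sup>2)"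
      by (rule Cauchy_Schwarz_ineq_sum)
    also have "(\<Sum>q\<in>?P. (sqrt (2 * L * real (card (I q))))\<^sup>2) = 2 * L * real T"
      using L_nonneg by (simp add: sum_distrib_left[symmetric] cardI del: One_nat_def)
    also have "(\<Sum>q\<in>?P. (1::real)\<^sup>2) * (2 * L * real T) \<le> (real K * real m) * (2 * L * real T)"
      using cardP L_nonneg by (intro mult_right_mono) auto
    finally have "(\<Sum>q\<in>?P. sqrt (2 * L * real (card (I q)))) \<le> sqrt ((real K * real m) * (2 * L * real T))"
      by (intro real_le_rsqrt) simp
    also have "\<dots> = sqrt (2 * L) * sqrt (real K * real T * real m)"
      by (simp add: real_sqrt_mult mult_ac)
    finally show ?thesis .
  qed
  finally show ?thesis using cardP by simp
qed

end

section \<open>Predictability and measurability of the chosen arm\<close>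

text \<open>The state after round \<open>r\<close> contains the active set of round
  \<open>r\<close>, but that set is computed from earlier rounds, whose observations all precede the
  start of round \<open>r\<close>. Hence \<open>u\<close> only has to reach that start.\<close>

lemma sb_state_nonanticipating:
  assumes K: "K \<ge> 1"
    and agree: "\<And>k t. k \<in> {1..K} \<Longrightarrow> 1 \<le> t \<Longrightarrow> t < u \<Longrightarrow> x k t = y k t"
    and "sb_start K T B x r \<le> u"
  shows "sb_state K T B x r = sb_state K T B y r"
  using assms(3)
proof (induction r)
  case (Suc r)
  interpret selective_bandits K T B x by unfold_locales (rule K)
  obtain p Ks U where st: "sb_state K T B x r = (p, Ks, U)" by (metis prod_cases3)
  have eq: "sb_state K T B y r = (p, Ks, U)"
    using Suc S_mono[of r "Suc r"] st by simp
  have KU: "Ks j = A j" "U j = S j" if "j \<le> r" for j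
    using state_active[OF that] state_start[of j r] that st by simp_all
  have "tildeDelta K T B x Ks U p r' k = tildeDelta K T B y Ks U p r' k" if "r' \<le> Suc r" for r' k
  proof (rule tildeDelta_cong)
    fix j assume j: "p \<le> j" "j < r'" "k \<in> Ks j"
    then have "j \<le> r" using that by simp
    then have pt: "pull_time Ks U j k = pull_time A S j k" and kA: "k \<in> A j"
      using KU j by (auto simp: pull_time_def)
    have "pull_time A S j k < u"
      using pull_time_bounds(2)[OF kA] S_mono[of "Suc j" "Suc r"] \<open>j \<le> r\<close> Suc.prems by linarith
    moreover have "1 \<le> pull_time A S j k"
      using pull_time_bounds(1)[OF kA] S_ge_1[of j] by linarith
    moreover have "k \<in> {1..K}" using A_subset[of j] kA by blast
    ultimately show "x k (pull_time Ks U j k) = y k (pull_time Ks U j k)"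
      unfolding pt by (intro agree)
  qed simp
  then have "active_set K T B x Ks U p (Suc r) = active_set K T B y Ks U p (Suc r)"
    unfolding active_set_def by (intro Collect_cong) auto
  then show ?case using st eq by simp
qed simp

lemma sb_arm_nonanticipating:
  assumes K: "K \<ge> 1" and t: "1 \<le> t"
    and agree: "\<And>k t'. k \<in> {1..K} \<Longrightarrow> 1 \<le> t' \<Longrightarrow> t' < t \<Longrightarrow> x k t' = y k t'"
  shows "sb_arm K T B x t = sb_arm K T B y t"
proof -
  interpret X: selective_bandits K T B x by unfold_locales (rule K)
  interpret Y: selective_bandits K T B y by unfold_locales (rule K)
  let ?j = "X.round t"
  \<comment> \<open>The round of \<open>t\<close> starts no later than \<open>t\<close>, so both
    runs share its active set and start, and the offset of \<open>t\<close> selects the same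
    arm.\<close>
  have "sb_state K T B x ?j = sb_state K T B y ?j"
    by (rule sb_state_nonanticipating[OF K agree X.round_bounds(1)[OF t]])
  then have eq: "X.A ?j = Y.A ?j" "X.S ?j = Y.S ?j"
    by (simp_all add: sb_active_def sb_start_def)
  have "pull_time Y.A Y.S ?j (X.arm t) = t"
    using X.pull_time_arm[OF t] eq by (simp add: pull_time_def)
  moreover have "Y.arm (pull_time Y.A Y.S ?j (X.arm t)) = X.arm t"
    using X.arm_in_A[OF t] eq by (intro Y.arm_pull_time) simp
  ultimately show ?thesis by simp
qed

text \<open>The range is finite, so preimages of singletons suffice; each is a finite Boolean
  combination of conditions on measurable statistics.\<close>

lemma measurable_active_set:
  assumes [measurable]: "\<And>k t. Y k t \<in> borel_measurable N"
  shows "(\<lambda>\<omega>. active_set K T B (\<lambda>k t. Y k t \<omega>) Ks S p n) \<in> measurable N (count_space (Pow {1..K}))"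
proof -
  have [measurable]: "(\<lambda>\<omega>. tildeDelta K T B (\<lambda>k t. Y k t \<omega>) Ks S p r k) \<in> borel_measurable N" for r k
    unfolding tildeDelta_def hatDelta_def obs_def by measurable
  have "(\<lambda>\<omega>. active_set K T B (\<lambda>k t. Y k t \<omega>) Ks S p n) -` {a} \<inter> space N \<in> sets N"
    if "a \<in> Pow {1..K}" for a
  proof -
    have eq: "active_set K T B y Ks S p n = a \<longleftrightarrow>
        (\<forall>k\<in>{1..K}. (\<forall>r\<in>{p..n}. tildeDelta K T B y Ks S p r k = 0) = (k \<in> a))" for y
      unfolding active_set_def using that by blast
    have "(\<lambda>\<omega>. active_set K T B (\<lambda>k t. Y k t \<omega>) Ks S p n) -` {a} \<inter> space N =
      {\<omega> \<in> space N. \<forall>k\<in>{1..K}. (\<forall>r\<in>{p..n}. tildeDelta K T B (\<lambda>k t. Y k t \<omega>) Ks S p r k = 0) = (k \<in> a)}"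
      by (simp only: vimage_def eq[symmetric] Int_def) (simp add: conj_commute)
    also have "\<dots> \<in> sets N" by measurable
    finally show ?thesis .
  qed
  then show ?thesis
    using active_set_subset by (subst measurable_count_space_eq2) auto
qed

text \<open>States contain functions and range over an uncountable type, but those reachable after
  \<open>r\<close> rounds lie in a countable set, on which the discrete sigma-algebra is
  enough.\<close>

lemma measurable_sb_state:
  assumes Y: "\<And>k t. Y k t \<in> borel_measurable N"
  shows "\<exists>I. countable I \<and> (\<lambda>\<omega>. sb_state K T B (\<lambda>k t. Y k t \<omega>) r) \<in> measurable N (count_space I)"
proof (induction r)
  case 0
  show ?case by (intro exI[of _ "{sb_state K T B (\<lambda>k t. Y k t undefined) 0}"]) simp
next
  case (Suc r)
  then obtain I where I: "countable I"
    and st: "(\<lambda>\<omega>. sb_state K T B (\<lambda>k t. Y k t \<omega>) r) \<in> measurable N (count_space I)" by blast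
  define step where "step st Kn = (case st of (p, Ks, S) \<Rightarrow>
      (if Kn = {} then Suc r else p, Ks(Suc r := Kn), S(Suc (Suc r) := S (Suc r) + card Kn)))"
    for st :: "nat \<times> (nat \<Rightarrow> nat set) \<times> (nat \<Rightarrow> nat)" and Kn :: "nat set"
  define next_st where "next_st st \<omega> = step st
      (active_set K T B (\<lambda>k t. Y k t \<omega>) (fst (snd st)) (snd (snd st)) (fst st) (Suc r))" for st \<omega>
  define J where "J = (\<lambda>(st, Kn). step st Kn) ` (I \<times> Pow {1..K})"
  have J: "countable J"
    unfolding J_def using I by (intro countable_image countable_SIGMA) (auto intro: countable_finite)
  have next_meas: "next_st st \<in> measurable N (count_space J)" if "st \<in> I" for st
    unfolding next_st_def
    by (rule measurable_compose[OF measurable_active_set[OF Y]]) (use that in \<open>auto simp: J_def\<close>)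
  have "(\<lambda>\<omega>. sb_state K T B (\<lambda>k t. Y k t \<omega>) (Suc r))
      = (\<lambda>\<omega>. next_st (sb_state K T B (\<lambda>k t. Y k t \<omega>) r) \<omega>)"
    by (simp add: fun_eq_iff next_st_def step_def Let_def split: prod.split)
  \<comment> \<open>For each fixed state the next one is measurable; countability of
    \<open>I\<close> allows substituting the random state.\<close>
  also have "\<dots> \<in> measurable N (count_space J)"
    by (rule measurable_compose_countable'[OF next_meas st I])
  finally show ?case using J by blast
qed

text \<open>No two consecutive rounds are empty, so the pulls up to time \<open>t\<close> belong to the rounds up to \<open>2 * t\<close>.\<close>
lemma sb_arm_sb_state:
  assumes "K \<ge> 1"
  shows "sb_arm K T B x t = (case sb_state K T B x (2 * t) of (p, Ks, S) \<Rightarrow>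
    (THE k. \<exists>j\<in>{1..2 * t}. k \<in> Ks j \<and> S j + card {i \<in> Ks j. i < k} = t))"
proof -
  interpret selective_bandits K T B x by unfold_locales (rule assms)
  obtain p Ks U where st: "sb_state K T B x (2 * t) = (p, Ks, U)" by (metis prod_cases3)
  have KU: "Ks j = A j \<and> U j = S j" if "j \<le> 2 * t" for j
    using state_active[OF that] state_start[of j "2 * t"] that st by simp
  have bound: "j \<le> 2 * t" if "S j \<le> t" for j
  proof (rule ccontr)
    assume "\<not> j \<le> 2 * t"
    then have "S (Suc (2 * t)) \<le> S j" by (intro S_mono) linarith
    with S_unbounded[of t] that show False by linarith
  qed
  have "(\<exists>j\<ge>1. k \<in> A j \<and> S j + card {i \<in> A j. i < k} = t) \<longleftrightarrow>
    (\<exists>j\<in>{1..2 * t}. k \<in> Ks j \<and> U j + card {i \<in> Ks j. i < k} = t)" for k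
  proof
    assume "\<exists>j\<ge>1. k \<in> A j \<and> S j + card {i \<in> A j. i < k} = t"
    then obtain j where j: "1 \<le> j" "k \<in> A j" "S j + card {i \<in> A j. i < k} = t" by blast
    then have "j \<le> 2 * t" by (intro bound) linarith
    with j KU show "\<exists>j\<in>{1..2 * t}. k \<in> Ks j \<and> U j + card {i \<in> Ks j. i < k} = t" by auto
  next
    assume "\<exists>j\<in>{1..2 * t}. k \<in> Ks j \<and> U j + card {i \<in> Ks j. i < k} = t"
    then obtain j where j: "j \<in> {1..2 * t}" "k \<in> Ks j" "U j + card {i \<in> Ks j. i < k} = t" by blast
    then have "1 \<le> j" "Ks j = A j" "U j = S j" using KU[of j] by simp_all
    with j show "\<exists>j\<ge>1. k \<in> A j \<and> S j + card {i \<in> A j. i < k} = t" by metis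
  qed
  then show ?thesis by (simp add: sb_arm_def st)
qed

lemma measurable_sb_arm:
  assumes K: "K \<ge> 1" and Y: "\<And>k t. Y k t \<in> borel_measurable N"
  shows "(\<lambda>\<omega>. sb_arm K T B (\<lambda>k t. Y k t \<omega>) t) \<in> measurable N (count_space UNIV)"
proof -
  obtain I where "(\<lambda>\<omega>. sb_state K T B (\<lambda>k t. Y k t \<omega>) (2 * t)) \<in> measurable N (count_space I)"
    using measurable_sb_state[of Y N K T B "2 * t", OF Y] by blast
  then show ?thesis
    unfolding sb_arm_sb_state[OF K] by (rule measurable_compose) simp
qed

section \<open>Concentration along predictable selections\<close>

lemma (in prob_space) indep_var_nn_integral_mult:
  fixes f g :: "'a \<Rightarrow> ennreal"
  assumes "indep_var borel f borel g"
  shows "(\<integral>\<^sup>+\<omega>. f \<omega> * g \<omega> \<partial>M) = (\<integral>\<^sup>+\<omega>. f \<omega> \<partial>M) * (\<integral>\<^sup>+\<omega>. g \<omega> \<partial>M)"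
proof -
  have "indep_vars (\<lambda>_. borel) (case_bool f g) UNIV"
    using assms unfolding indep_var_def
    by (rule back_subst[where P = "\<lambda>b. indep_vars b _ _"]) (simp add: fun_eq_iff split: bool.split)
  from indep_vars_nn_integral[OF _ this] show ?thesis
    by (simp add: UNIV_bool mult.commute)
qed

text \<open>The process multiplying up \<open>\<phi> t (X k t)\<close> along the selected times is a supermartingale,
  because the selection at time \<open>t\<close> only depends on the observations before \<open>t\<close>.\<close>
lemma (in prob_space) nn_integral_predictable_prod_le_1:
  fixes X :: "nat \<Rightarrow> nat \<Rightarrow> 'a \<Rightarrow> real"
    and h :: "nat \<Rightarrow> (nat \<times> nat \<Rightarrow> real) \<Rightarrow> bool"
  assumes indep: "indep_vars (\<lambda>_. borel) (\<lambda>(k, t). X k t) ({1..K} \<times> {1..T})"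
    and k: "k \<in> {1..K}"
    and h [measurable]: "\<And>t. Measurable.pred (PiM UNIV (\<lambda>_. borel)) (h t)"
    and predictable: "\<And>t z z'. t \<in> {1..T} \<Longrightarrow>
      (\<And>i. i \<in> {1..K} \<times> {1..<t} \<Longrightarrow> z i = z' i) \<Longrightarrow> h t z = h t z'"
    and \<phi> [measurable]: "\<And>t. \<phi> t \<in> borel_measurable borel"
    and \<phi>_le: "\<And>t. t \<in> {1..T} \<Longrightarrow> (\<integral>\<^sup>+\<omega>. \<phi> t (X k t \<omega>) \<partial>M) \<le> 1"
    and m: "m \<le> T"
  shows "(\<integral>\<^sup>+\<omega>. (\<Prod>t\<in>{1..m}. if h t (\<lambda>(k, t). X k t \<omega>) then \<phi> t (X k t \<omega>) else 1 :: ennreal) \<partial>M) \<le> 1"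
  using m
proof (induction m)
  case 0
  then show ?case by (simp add: emeasure_space_1)
next
  case (Suc m)
  let ?J = "{1..K} \<times> {1..<Suc m}"
  let ?U = "\<lambda>\<omega>. restrict (\<lambda>i. (\<lambda>(k, t). X k t) i \<omega>) ?J"
  \<comment> \<open>Pads a restricted history to a total point at which \<open>h\<close> can be
    evaluated; by predictability the padding changes no decision up to time
    \<open>Suc m\<close>.\<close>
  define ext where "ext u = (\<lambda>i. if i \<in> ?J then u i else 0)" for u :: "nat \<times> nat \<Rightarrow> real"
  have ext [measurable]: "ext \<in> measurable (PiM ?J (\<lambda>_. borel)) (PiM UNIV (\<lambda>_. borel))"
    unfolding ext_def
  proof (rule measurable_abs_UNIV)
    fix i show "(\<lambda>u. if i \<in> ?J then u i else 0) \<in> borel_measurable (PiM ?J (\<lambda>_. borel))"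
      by (cases "i \<in> ?J") simp_all
  qed
  define Z where "Z v = (\<Prod>t\<in>{1..m}. if h t v then \<phi> t (v (k, t)) else 1)" for v
  have Z [measurable]: "Z \<in> borel_measurable (PiM UNIV (\<lambda>_. borel))"
    unfolding Z_def by measurable
  define H where "H v = h (Suc m) v" for v
  have H [measurable]: "Measurable.pred (PiM UNIV (\<lambda>_. borel)) H"
    unfolding H_def by measurable
  have rv: "X k t \<in> borel_measurable M" if "t \<in> {1..T}" for t
    using indep k that by (force simp: indep_vars_def)
  have indepU: "indep_var (PiM ?J (\<lambda>_. borel)) ?U (PiM {(k, Suc m)} (\<lambda>_. borel))
      (\<lambda>\<omega>. restrict (\<lambda>i. (\<lambda>(k, t). X k t) i \<omega>) {(k, Suc m)})"
    using k Suc.prems by (intro indep_var_restrict[OF indep]) auto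
  have U [measurable]: "?U \<in> measurable M (PiM ?J (\<lambda>_. borel))"
    using indepU by (rule indep_var_rv1)
  have extU: "ext (?U \<omega>) i = (\<lambda>(k, t). X k t \<omega>) i" if "i \<in> ?J" for i \<omega>
    using that by (auto simp: ext_def split: prod.split)
  have h_eq: "h t (\<lambda>(k, t). X k t \<omega>) = h t (ext (?U \<omega>))" if "t \<in> {1..Suc m}" for t \<omega>
    using that Suc.prems by (intro predictable extU[symmetric]) auto
  have Z_eq: "(\<Prod>t\<in>{1..m}. if h t (\<lambda>(k, t). X k t \<omega>) then \<phi> t (X k t \<omega>) else 1) = Z (ext (?U \<omega>))" for \<omega>
    unfolding Z_def using k by (intro prod.cong if_cong h_eq refl) (auto simp: ext_def)
  have prod_Suc: "(\<Prod>t\<in>{1..Suc m}. if h t (\<lambda>(k, t). X k t \<omega>) then \<phi> t (X k t \<omega>) else 1)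
      = Z (ext (?U \<omega>)) * (if H (ext (?U \<omega>)) then \<phi> (Suc m) (X k (Suc m) \<omega>) else 1)" for \<omega>
    using Z_eq[of \<omega>] h_eq[of "Suc m" \<omega>] by (simp add: H_def)
  \<comment> \<open>Past and fresh observation are functions of disjoint blocks of an independent
    family.\<close>
  have indep': "indep_var borel (\<lambda>\<omega>. Z (ext (?U \<omega>)) * indicator {v. H v} (ext (?U \<omega>)))
      borel (\<lambda>\<omega>. \<phi> (Suc m) (X k (Suc m) \<omega>))"
  proof -
    have "indep_var borel ((\<lambda>u. Z (ext u) * indicator {v. H v} (ext u)) \<circ> ?U)
      borel ((\<lambda>u. \<phi> (Suc m) (u (k, Suc m))) \<circ> (\<lambda>\<omega>. restrict (\<lambda>i. (\<lambda>(k, t). X k t) i \<omega>) {(k, Suc m)}))"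
      by (rule indep_var_compose[OF indepU]) measurable
    then show ?thesis by (simp add: comp_def)
  qed
  have rvS [measurable]: "X k (Suc m) \<in> borel_measurable M" using Suc.prems by (intro rv) auto
  \<comment> \<open>Split by whether time \<open>Suc m\<close> is selected: if so, the new factor
    has mean at most 1; otherwise it equals 1.\<close>
  let ?Z1 = "\<lambda>\<omega>. Z (ext (?U \<omega>)) * indicator {v. H v} (ext (?U \<omega>))"
  let ?Z0 = "\<lambda>\<omega>. Z (ext (?U \<omega>)) * indicator {v. \<not> H v} (ext (?U \<omega>))"
  have "(\<integral>\<^sup>+\<omega>. (\<Prod>t\<in>{1..Suc m}. if h t (\<lambda>(k, t). X k t \<omega>) then \<phi> t (X k t \<omega>) else 1) \<partial>M)
    = (\<integral>\<^sup>+\<omega>. ?Z1 \<omega> * \<phi> (Suc m) (X k (Suc m) \<omega>) + ?Z0 \<omega> \<partial>M)"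
    unfolding prod_Suc by (intro nn_integral_cong) (simp add: indicator_def)
  also have "\<dots> = (\<integral>\<^sup>+\<omega>. ?Z1 \<omega> * \<phi> (Suc m) (X k (Suc m) \<omega>) \<partial>M) + (\<integral>\<^sup>+\<omega>. ?Z0 \<omega> \<partial>M)"
    by (rule nn_integral_add) measurable
  also have "\<dots> = (\<integral>\<^sup>+\<omega>. ?Z1 \<omega> \<partial>M) * (\<integral>\<^sup>+\<omega>. \<phi> (Suc m) (X k (Suc m) \<omega>) \<partial>M) + (\<integral>\<^sup>+\<omega>. ?Z0 \<omega> \<partial>M)"
    unfolding indep_var_nn_integral_mult[OF indep'] ..
  also have "\<dots> \<le> (\<integral>\<^sup>+\<omega>. ?Z1 \<omega> \<partial>M) * 1 + (\<integral>\<^sup>+\<omega>. ?Z0 \<omega> \<partial>M)"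
    using Suc.prems by (intro add_right_mono mult_left_mono \<phi>_le) auto
  also have "\<dots> = (\<integral>\<^sup>+\<omega>. ?Z1 \<omega> + ?Z0 \<omega> \<partial>M)"
    unfolding mult_1_right by (rule nn_integral_add[symmetric]) measurable
  also have "\<dots> = (\<integral>\<^sup>+\<omega>. Z (ext (?U \<omega>)) \<partial>M)"
    by (intro nn_integral_cong) (simp add: indicator_def)
  also have "\<dots> \<le> 1" using Suc.IH Suc.prems by (simp only: Z_eq)
  finally show ?case .
qed

text \<open>Chernoff's method: on \<open>D\<close> the product supermartingale is at least
  \<open>exp L\<close>, while its mean is at most 1. Each selected time costs \<open>l^2 / 8\<close>
  in the exponent, and at most \<open>n\<close> times are selected.\<close>

lemma (in prob_space) azuma_hoeffding_predictable:
  fixes X :: "nat \<Rightarrow> nat \<Rightarrow> 'a \<Rightarrow> real"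
    and h :: "nat \<Rightarrow> (nat \<times> nat \<Rightarrow> real) \<Rightarrow> bool"
  assumes indep: "indep_vars (\<lambda>_. borel) (\<lambda>(k, t). X k t) ({1..K} \<times> {1..T})"
    and k: "k \<in> {1..K}"
    and h [measurable]: "\<And>t. Measurable.pred (PiM UNIV (\<lambda>_. borel)) (h t)"
    and predictable: "\<And>t z z'. t \<in> {1..T} \<Longrightarrow>
      (\<And>i. i \<in> {1..K} \<times> {1..<t} \<Longrightarrow> z i = z' i) \<Longrightarrow> h t z = h t z'"
    and w [measurable]: "\<And>t. w t \<in> borel_measurable borel"
    and range: "\<And>t. t \<in> {1..T} \<Longrightarrow> AE \<omega> in M. w t (X k t \<omega>) \<in> {a t..a t + 1}"
    and mean: "\<And>t. t \<in> {1..T} \<Longrightarrow> expectation (\<lambda>\<omega>. w t (X k t \<omega>)) = 0"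
    and n: "1 \<le> n" and count: "\<And>z. card {t \<in> {1..T}. h t z} \<le> n"
    and L: "0 < L"
  defines "D \<equiv> {\<omega> \<in> space M. sqrt (real n * L / 2) <
      (\<Sum>t\<in>{t \<in> {1..T}. h t (\<lambda>(k, t). X k t \<omega>)}. w t (X k t \<omega>))}"
  shows "D \<in> events" "prob D \<le> exp (- L)"
proof -
  have rv: "X k t \<in> borel_measurable M" if "k \<in> {1..K}" "t \<in> {1..T}" for k t
    using indep that by (force simp: indep_vars_def)
  \<comment> \<open>Measurability is available only for indices in
    \<open>{1..K} \<times> {1..T}\<close>; \<open>V\<close> sets the others to 0, which by
    predictability changes no decision.\<close>
  define V where "V \<omega> = (\<lambda>i. if i \<in> {1..K} \<times> {1..T} then (\<lambda>(k, t). X k t \<omega>) i else 0)" for \<omega>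
  have V [measurable]: "V \<in> measurable M (PiM UNIV (\<lambda>_. borel))"
    unfolding V_def
  proof (rule measurable_abs_UNIV)
    fix i show "(\<lambda>\<omega>. if i \<in> {1..K} \<times> {1..T} then (\<lambda>(k, t). X k t \<omega>) i else 0) \<in> borel_measurable M"
      by (cases "i \<in> {1..K} \<times> {1..T}") (auto simp: rv split: prod.split)
  qed
  have hV: "h t (\<lambda>(k, t). X k t \<omega>) = h t (V \<omega>)" if "t \<in> {1..T}" for t \<omega>
    using that by (intro predictable) (auto simp: V_def)
  define W where "W \<omega> = (\<Sum>t\<in>{t \<in> {1..T}. h t (\<lambda>(k, t). X k t \<omega>)}. w t (X k t \<omega>))" for \<omega>
  have W_eq: "W \<omega> = (\<Sum>t\<in>{1..T}. if h t (V \<omega>) then w t (V \<omega> (k, t)) else 0)" for \<omega>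
  proof -
    have "W \<omega> = (\<Sum>t\<in>{1..T}. if h t (\<lambda>(k, t). X k t \<omega>) then w t (X k t \<omega>) else 0)"
      unfolding W_def by (rule sum.inter_filter) simp
    also have "\<dots> = (\<Sum>t\<in>{1..T}. if h t (V \<omega>) then w t (V \<omega> (k, t)) else 0)"
      using k by (intro sum.cong if_cong hV refl) (auto simp: V_def)
    finally show ?thesis .
  qed
  have W [measurable]: "W \<in> borel_measurable M"
    unfolding W_eq by measurable
  have D_eq: "D = {\<omega> \<in> space M. sqrt (real n * L / 2) < W \<omega>}"
    by (simp add: D_def W_def)
  show D: "D \<in> events" unfolding D_eq by measurable

  define \<Delta> where "\<Delta> = sqrt (real n * L / 2)"
  \<comment> \<open>The maximiser of \<open>l * \<Delta> - n * l^2 / 8\<close>; the maximum is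
    \<open>2 * \<Delta>^2 / n = L\<close>.\<close>
  define l where "l = 4 * \<Delta> / real n"
  have \<Delta>: "0 < \<Delta>" "\<Delta>\<^sup>2 = real n * L / 2" using n L by (simp_all add: \<Delta>_def)
  have l: "0 < l" using \<Delta> n by (simp add: l_def)
  \<comment> \<open>Hoeffding's lemma for a range of length 1 gives exponential moment at most
    \<open>exp (l^2 / 8)\<close>, so the subtraction brings the mean to at most 1.\<close>
  define \<phi> where "\<phi> t y = ennreal (exp (l * w t y - l\<^sup>2 / 8))" for t y
  have \<phi> [measurable]: "\<phi> t \<in> borel_measurable borel" for t unfolding \<phi>_def by measurable
  have \<phi>_le: "(\<integral>\<^sup>+\<omega>. \<phi> t (X k t \<omega>) \<partial>M) \<le> 1" if t: "t \<in> {1..T}" for t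
  proof -
    have [measurable]: "X k t \<in> borel_measurable M" by (rule rv[OF k t])
    interpret interval_bounded_random_variable M "\<lambda>\<omega>. w t (X k t \<omega>)" "a t" "a t + 1"
      by unfold_locales (use range[OF t] in auto)
    have "(\<integral>\<^sup>+\<omega>. \<phi> t (X k t \<omega>) \<partial>M)
        = (\<integral>\<^sup>+\<omega>. ennreal (exp (- (l\<^sup>2 / 8))) * ennreal (exp (l * w t (X k t \<omega>))) \<partial>M)"
      unfolding \<phi>_def by (intro nn_integral_cong) (simp add: ennreal_mult[symmetric] exp_add[symmetric])
    also have "\<dots> = ennreal (exp (- (l\<^sup>2 / 8))) * (\<integral>\<^sup>+\<omega>. exp (l * w t (X k t \<omega>)) \<partial>M)"
      by (rule nn_integral_cmult) measurable
    also have "\<dots> \<le> ennreal (exp (- (l\<^sup>2 / 8))) * ennreal (exp (l\<^sup>2 * (a t + 1 - a t)\<^sup>2 / 8))"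
      by (intro mult_left_mono Hoeffdings_lemma_nn_integral_0 l mean t) simp
    also have "\<dots> = 1" by (simp add: ennreal_mult[symmetric] exp_add[symmetric])
    finally show ?thesis .
  qed
  define P where "P \<omega> = (\<Prod>t\<in>{1..T}. if h t (\<lambda>(k, t). X k t \<omega>) then \<phi> t (X k t \<omega>) else 1)" for \<omega>
  have P_le: "(\<integral>\<^sup>+\<omega>. P \<omega> \<partial>M) \<le> 1"
    unfolding P_def
    by (rule nn_integral_predictable_prod_le_1[OF indep k h predictable \<phi> \<phi>_le]) auto
  have P_ge: "ennreal (exp L) * indicator D \<omega> \<le> P \<omega>" for \<omega>
  proof (cases "\<omega> \<in> D")
    case True
    let ?I = "{t \<in> {1..T}. h t (\<lambda>(k, t). X k t \<omega>)}"
    have "P \<omega> = (\<Prod>t\<in>?I. \<phi> t (X k t \<omega>))"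
      unfolding P_def by (rule prod.inter_filter[symmetric]) simp
    also have "\<dots> = ennreal (exp (\<Sum>t\<in>?I. l * w t (X k t \<omega>) - l\<^sup>2 / 8))"
      by (simp add: \<phi>_def prod_ennreal exp_sum)
    also have "(\<Sum>t\<in>?I. l * w t (X k t \<omega>) - l\<^sup>2 / 8) = l * W \<omega> - real (card ?I) * (l\<^sup>2 / 8)"
      by (simp add: sum_subtractf sum_distrib_left[symmetric] W_def)
    finally have P: "P \<omega> = ennreal (exp (l * W \<omega> - real (card ?I) * (l\<^sup>2 / 8)))" .
    have "L = l * \<Delta> - real n * (l\<^sup>2 / 8)"
      using \<Delta> n by (simp add: l_def field_simps power2_eq_square)
    also have "\<dots> \<le> l * W \<omega> - real (card ?I) * (l\<^sup>2 / 8)"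
      using True l count[of "\<lambda>(k, t). X k t \<omega>"]
      by (intro diff_mono mult_left_mono mult_right_mono) (auto simp: D_eq \<Delta>_def)
    finally show ?thesis using True by (simp add: P ennreal_leI)
  qed simp
  have "ennreal (exp L) * emeasure M D = (\<integral>\<^sup>+\<omega>. ennreal (exp L) * indicator D \<omega> \<partial>M)"
    using D by (simp add: nn_integral_cmult_indicator)
  also have "\<dots> \<le> (\<integral>\<^sup>+\<omega>. P \<omega> \<partial>M)" by (intro nn_integral_mono P_ge)
  also have "\<dots> \<le> 1" by (rule P_le)
  finally have "ennreal (exp L * prob D) \<le> ennreal 1"
    by (simp add: emeasure_eq_measure ennreal_mult)
  then have "exp L * prob D \<le> 1" by (subst (asm) ennreal_le_iff) auto
  then show "prob D \<le> exp (- L)" by (simp add: exp_minus field_simps)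
qed

text \<open>Azuma-Hoeffding for the first \<open>n\<close> pulls of \<open>k\<close> from time
  \<open>s\<close> on; the sign \<open>\<sigma>\<close> provides the two tails.\<close>

lemma (in prob_space) sb_deviation_prob:
  fixes X :: "nat \<Rightarrow> nat \<Rightarrow> 'a \<Rightarrow> real" and g :: "nat \<Rightarrow> nat \<Rightarrow> real"
    and s :: nat and B :: real
  assumes K: "K \<ge> 1"
    and indep: "indep_vars (\<lambda>_. borel) (\<lambda>(k, t). X k t) ({1..K} \<times> {1..T})"
    and bounded: "\<And>k t. k \<in> {1..K} \<Longrightarrow> t \<in> {1..T} \<Longrightarrow> AE \<omega> in M. 0 \<le> - X k t \<omega> \<and> - X k t \<omega> \<le> 1"
    and mean: "\<And>k t. k \<in> {1..K} \<Longrightarrow> t \<in> {1..T} \<Longrightarrow> expectation (X k t) = - g k t"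
    and k: "k \<in> {1..K}" and s: "1 \<le> s" and n: "1 \<le> n" and L: "0 < L" and \<sigma>: "\<sigma> \<in> {1, -1 :: real}"
  defines "D \<equiv> {\<omega> \<in> space M. sqrt (real n * L / 2) <
    (\<Sum>t\<in>{t \<in> {1..T}. s \<le> t \<and> sb_arm K T B (\<lambda>k t. X k t \<omega>) t = k \<and>
        card (selective_bandits.pulls K T B (\<lambda>k t. X k t \<omega>) k s t) < n}. \<sigma> * (X k t \<omega> + g k t))}"
  shows "D \<in> events \<and> prob D \<le> exp (- L)"
proof -
  have sb: "selective_bandits K" by unfold_locales (rule K)
  note pulls = selective_bandits.pulls_def[OF sb]
  define arm where "arm z t = sb_arm K T B (\<lambda>k t. z (k, t)) t" for z :: "nat \<times> nat \<Rightarrow> real" and t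
  define h where "h t z \<longleftrightarrow> s \<le> t \<and> arm z t = k \<and> card {t' \<in> {s..<t}. arm z t' = k} < n" for t z
  define w where "w t y = \<sigma> * (y + g k t)" for t y
  \<comment> \<open>As \<open>X k t\<close> lies in \<open>[-1, 0]\<close>, the centred noise lies
    in \<open>[g k t - 1, g k t]\<close> and its negative in
    \<open>[- g k t, 1 - g k t]\<close>.\<close>
  define a where "a t = (if \<sigma> = 1 then g k t - 1 else - g k t)" for t
  have arm [measurable]: "(\<lambda>z. arm z t) \<in> measurable (PiM UNIV (\<lambda>_. borel)) (count_space UNIV)" for t
    unfolding arm_def by (rule measurable_sb_arm[OF K]) measurable
  have [measurable]: "Measurable.pred (PiM UNIV (\<lambda>_. borel)) (h t)" for t
    unfolding h_def by measurable
  have arm_cong: "arm z t = arm z' t"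
    if "1 \<le> t" "\<And>i. i \<in> {1..K} \<times> {1..<t} \<Longrightarrow> z i = z' i" for t z z'
    unfolding arm_def using that by (intro sb_arm_nonanticipating[OF K]) auto
  have predictable: "h t z = h t z'"
    if t: "t \<in> {1..T}" and eq: "\<And>i. i \<in> {1..K} \<times> {1..<t} \<Longrightarrow> z i = z' i" for t z z'
  proof -
    have "arm z t = arm z' t" using t eq by (intro arm_cong) auto
    moreover have "arm z t' = arm z' t'" if "t' \<in> {s..<t}" for t'
      using that s by (intro arm_cong eq) auto
    then have "{t' \<in> {s..<t}. arm z t' = k} = {t' \<in> {s..<t}. arm z' t' = k}" by auto
    ultimately show ?thesis by (simp only: h_def)
  qed
  have rv [measurable]: "X k t \<in> borel_measurable M" if "t \<in> {1..T}" for t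
    using indep k that by (force simp: indep_vars_def)
  have w [measurable]: "w t \<in> borel_measurable borel" for t
    unfolding w_def by measurable
  have range: "AE \<omega> in M. w t (X k t \<omega>) \<in> {a t..a t + 1}" if "t \<in> {1..T}" for t
    using bounded[OF k that] by eventually_elim (use \<sigma> in \<open>auto simp: w_def a_def\<close>)
  have mean_0: "expectation (\<lambda>\<omega>. w t (X k t \<omega>)) = 0" if t: "t \<in> {1..T}" for t
  proof -
    have "AE \<omega> in M. norm (X k t \<omega>) \<le> 1"
      using bounded[OF k t] by eventually_elim auto
    then have "integrable M (X k t)" using rv[OF t] by (rule integrable_const_bound)
    then show ?thesis using mean[OF k t] by (simp add: w_def prob_space)
  qed
  have h_pulls: "h t (\<lambda>(k, t). y k t) \<longleftrightarrow> s \<le> t \<and> sb_arm K T B y t = k \<and>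
      card (selective_bandits.pulls K T B y k s t) < n" for t y
    by (simp add: h_def arm_def pulls)
  have count: "card {t \<in> {1..T}. h t z} \<le> n" for z
  proof -
    have "h t z \<longleftrightarrow> h t (\<lambda>(k, t). z (k, t))" for t by simp
    then show ?thesis
      unfolding h_pulls by (simp only: selective_bandits.card_first_pulls_le[OF sb])
  qed
  show ?thesis
    using azuma_hoeffding_predictable[where h = h and w = w and a = a and n = n and L = L,
        OF indep k _ predictable w range mean_0 n count L]
    by (simp add: D_def h_pulls w_def)
qed

section \<open>The expected regret bound\<close>

lemma sqrt_two_mult_le:
  fixes L c :: real
  assumes "0 \<le> L" "1 \<le> c"
  shows "sqrt (2 * L) \<le> 2 powr (3/2) + 2 powr (1/2) * c * L"
proof -
  have "sqrt L \<le> 1 + L"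
    using assms by (intro real_le_lsqrt) (auto simp: power2_eq_square algebra_simps)
  also have "\<dots> \<le> 1 + c * L" using assms mult_right_mono[of 1 c L] by simp
  finally have "sqrt 2 * sqrt L \<le> sqrt 2 * (1 + c * L)" by (rule mult_left_mono) simp
  moreover have "sqrt 2 = 2 powr (1/2)" by (simp add: powr_half_sqrt)
  ultimately have "sqrt (2 * L) \<le> 2 powr (1/2) + 2 powr (1/2) * c * L"
    by (simp add: real_sqrt_mult algebra_simps)
  moreover have "2 powr (1/2) \<le> (2 powr (3/2) :: real)" by (rule powr_mono) auto
  ultimately show ?thesis by linarith
qed

theorem theorem2:
  fixes M :: "'a measure" and X :: "nat \<Rightarrow> nat \<Rightarrow> 'a \<Rightarrow> real"
    and f :: "nat \<Rightarrow> real \<Rightarrow> real"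
    and K T Mseg :: nat and B c :: real
  assumes "prob_space M"
    and "K \<ge> 1" and "Mseg \<ge> 1" and "B > 0"
    and indep: "prob_space.indep_vars M (\<lambda>_. borel) (\<lambda>(k, t). X k t) ({1..K} \<times> {1..T})"
    and bounded: "\<forall>k\<in>{1..K}. \<forall>t\<in>{1..T}. AE \<omega> in M. 0 \<le> - X k t \<omega> \<and> - X k t \<omega> \<le> 1"
    and mean: "\<forall>k\<in>{1..K}. \<forall>t\<in>{1..T}. prob_space.expectation M (X k t) = - gap K T f k t"
    and segments: "\<exists>\<tau> :: nat \<Rightarrow> nat. \<tau> 1 = 1 \<and> \<tau> (Mseg + 1) = T + 1 \<and>
        (\<forall>m\<in>{1..Mseg}. \<tau> m < \<tau> (m + 1)) \<and>
        (\<forall>k\<in>{1..K}. \<forall>m\<in>{1..Mseg}. \<forall>t t'.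
           \<tau> m \<le> t \<and> t < \<tau> (m + 1) \<and> \<tau> m \<le> t' \<and> t' < \<tau> (m + 1) \<longrightarrow>
           (2 powr (-1/4) \<le> gap K T f k t / gap K T f k t' \<and>
            gap K T f k t / gap K T f k t' \<le> 2 powr (1/4))
           \<or> (0 \<le> gap K T f k t \<and> gap K T f k t \<le> 2 * max (1 / sqrt (real T)) B))"
    and "c \<ge> 16"
  shows "prob_space.expectation M
           (\<lambda>\<omega>. \<Sum>t\<in>{1..T}. gap K T f (sb_arm K T B (\<lambda>k t. X k t \<omega>) t) t)
         \<le> (2 powr (3/2) + 2 powr (1/2) * c * ln (2 * real K * real T ^ 3))
              * sqrt (real K * real T * real Mseg)
           + 2 * real K * real Mseg + 8 * real T * max B (1 / sqrt (real T)) + 1"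
proof -
  interpret prob_space M by fact
  define g where "g = gap K T f"
  define b where "b = max (1 / sqrt (real T)) B"
  define L where "L = ln (2 * real K * real T ^ 3)"
  obtain \<tau> :: "nat \<Rightarrow> nat" where \<tau>1: "\<tau> 1 = 1" and \<tau>M: "\<tau> (Mseg + 1) = T + 1"
    and \<tau>_less: "\<And>m. m \<in> {1..Mseg} \<Longrightarrow> \<tau> m < \<tau> (m + 1)"
    and \<tau>_gap: "\<And>k m t t'. k \<in> {1..K} \<Longrightarrow> m \<in> {1..Mseg} \<Longrightarrow>
      \<tau> m \<le> t \<Longrightarrow> t < \<tau> (m + 1) \<Longrightarrow> \<tau> m \<le> t' \<Longrightarrow> t' < \<tau> (m + 1) \<Longrightarrow>
      2 powr (-1/4) \<le> g k t / g k t' \<or> g k t \<le> 2 * b"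
    using segments unfolding g_def b_def by metis
  \<comment> \<open>Strictly increasing integers starting at 1; at \<open>Mseg + 1\<close> this
    gives \<open>Mseg \<le> T\<close>.\<close>
  have "m \<le> \<tau> m" if "1 \<le> m" "m \<le> Mseg + 1" for m
    using that by (induction m rule: dec_induct) (use \<tau>1 \<tau>_less in force)+
  from this[of "Mseg + 1"] have T: "1 \<le> T" using \<open>Mseg \<ge> 1\<close> \<tau>M by simp

  \<comment> \<open>Taking the least index makes \<open>seg\<close> monotone at once, and failure at
    the preceding index gives the lower end of the segment.\<close>
  define seg where "seg t = (LEAST m. 1 \<le> m \<and> t < \<tau> (m + 1))" for t
  have seg: "1 \<le> seg t" "t < \<tau> (seg t + 1)" "seg t \<le> Mseg" "\<tau> (seg t) \<le> t" if t: "t \<in> {1..T}" for t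
  proof -
    have ex: "1 \<le> Mseg \<and> t < \<tau> (Mseg + 1)" using t \<tau>M \<open>Mseg \<ge> 1\<close> by simp
    show *: "1 \<le> seg t" "t < \<tau> (seg t + 1)"
      using LeastI[of "\<lambda>m. 1 \<le> m \<and> t < \<tau> (m + 1)", OF ex] by (simp_all add: seg_def)
    show "seg t \<le> Mseg" unfolding seg_def by (rule Least_le) (rule ex)
    show "\<tau> (seg t) \<le> t"
    proof (cases "seg t = 1")
      case True
      then show ?thesis using t \<tau>1 by simp
    next
      case False
      then have "seg t - 1 < seg t" "1 \<le> seg t - 1" using *(1) by auto
      then have "\<not> t < \<tau> (seg t - 1 + 1)"
        using not_less_Least[of "seg t - 1" "\<lambda>m. 1 \<le> m \<and> t < \<tau> (m + 1)"] by (simp add: seg_def)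
      then show ?thesis using *(1) by simp
    qed
  qed
  have seg_mono: "seg t \<le> seg t'" if "t' \<in> {1..T}" "t \<le> t'" for t t'
    unfolding seg_def[of t] by (rule Least_le) (use seg[OF that(1)] that(2) in simp)
  have small: "\<exists>k\<in>{1..K}. \<forall>t\<in>{1..T}. seg t = seg s \<longrightarrow> g k t \<le> 2 * b" if s: "s \<in> {1..T}" for s
  proof -
    have "Max ((\<lambda>j. mean (real T) f j s) ` {1..K}) \<in> (\<lambda>j. mean (real T) f j s) ` {1..K}"
      using \<open>K \<ge> 1\<close> by (intro Max_in) auto
    then obtain k where k: "k \<in> {1..K}" "Max ((\<lambda>j. mean (real T) f j s) ` {1..K}) = mean (real T) f k s"
      by blast
    then have zero: "g k s = 0" by (simp add: g_def gap_def)
    have "g k t \<le> 2 * b" if t: "t \<in> {1..T}" "seg t = seg s" for t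
    proof -
      have "2 powr (-1/4) \<le> g k t / g k s \<or> g k t \<le> 2 * b"
        using seg[OF t(1)] seg[OF s] t(2) by (intro \<tau>_gap[of k "seg s"] k) auto
      \<comment> \<open>Division by the zero gap at \<open>s\<close> yields 0, so the ratio
        alternative fails and the additive one holds throughout the segment.\<close>
      moreover have "\<not> 2 powr (-1/4) \<le> g k t / g k s" by (simp add: zero not_le)
      ultimately show ?thesis by blast
    qed
    with k show ?thesis by blast
  qed

  have rv [measurable]: "X k t \<in> borel_measurable M" if "k \<in> {1..K}" "t \<in> {1..T}" for k t
    using indep that by (force simp: indep_vars_def)
  have gap01: "0 \<le> g k t \<and> g k t \<le> 1" if kt: "k \<in> {1..K}" "t \<in> {1..T}" for k t
  proof -
    have bd: "AE \<omega> in M. 0 \<le> - X k t \<omega> \<and> - X k t \<omega> \<le> 1" using bounded kt by blast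
    then have "AE \<omega> in M. norm (X k t \<omega>) \<le> 1" by eventually_elim auto
    then have "integrable M (X k t)" using rv[OF kt] by (rule integrable_const_bound)
    then have int: "integrable M (\<lambda>\<omega>. - X k t \<omega>)" by simp
    have "expectation (\<lambda>\<omega>. - X k t \<omega>) = g k t"
      using mean kt by (simp add: g_def)
    moreover have "0 \<le> expectation (\<lambda>\<omega>. - X k t \<omega>)"
      using int by (rule integral_ge_const) (use bd in \<open>eventually_elim, auto\<close>)
    moreover have "expectation (\<lambda>\<omega>. - X k t \<omega>) \<le> 1"
      using int by (rule integral_le_const) (use bd in \<open>eventually_elim, auto\<close>)
    ultimately show ?thesis by simp
  qed

  have KT: "1 \<le> real K" "1 \<le> real T" using \<open>K \<ge> 1\<close> T by auto
  have "1 * 1 \<le> real K * real T ^ 3" using KT by (intro mult_mono one_le_power) auto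
  then have two_le: "2 \<le> 2 * real K * real T ^ 3" by linarith
  then have L: "0 < L" unfolding L_def by (intro ln_gt_zero) linarith
  have exp_L: "exp (- L) = 1 / (2 * real K * real T ^ 3)"
    using two_le by (simp add: L_def exp_minus inverse_eq_divide)

  define D where "D = (\<lambda>(\<sigma>, k, s, n). {\<omega> \<in> space M. sqrt (real n * L / 2) <
    (\<Sum>t\<in>{t \<in> {1..T}. s \<le> t \<and> sb_arm K T B (\<lambda>k t. X k t \<omega>) t = k \<and>
        card (selective_bandits.pulls K T B (\<lambda>k t. X k t \<omega>) k s t) < n}. \<sigma> * (X k t \<omega> + g k t))})"
  \<comment> \<open>There are \<open>2 * K * T^2\<close> choices of sign, arm, start and count, each
    failing with probability at most \<open>1 / (2 * K * T^3)\<close>: in total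
    \<open>1 / T\<close>.\<close>
  define Q where "Q = {1, -1 :: real} \<times> {1..K} \<times> {1..T} \<times> {1..T}"
  define Bad where "Bad = (\<Union>q\<in>Q. D q)"
  have D: "D q \<in> events \<and> prob (D q) \<le> exp (- L)" if "q \<in> Q" for q
  proof -
    obtain \<sigma> k s n where q: "q = (\<sigma>, k, s, n)" by (metis prod_cases4)
    with that have *: "\<sigma> \<in> {1, -1}" "k \<in> {1..K}" "1 \<le> s" "1 \<le> n" by (auto simp: Q_def)
    show ?thesis unfolding q D_def split
      by (rule sb_deviation_prob[OF \<open>K \<ge> 1\<close> indep _ _ *(2,3,4) L *(1)])
        (use bounded mean in \<open>auto simp: g_def\<close>)
  qed
  have Bad [measurable]: "Bad \<in> events"
    unfolding Bad_def using D by (intro sets.finite_UN) (auto simp: Q_def)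
  have "prob Bad \<le> (\<Sum>q\<in>Q. prob (D q))"
    unfolding Bad_def using D by (intro measure_UNION_le) (auto simp: Q_def)
  also have "\<dots> \<le> real (card Q) * exp (- L)" using D by (intro sum_bounded_above) auto
  also have "real (card Q) = 2 * real K * real T * real T"
    by (simp add: Q_def card_cartesian_product)
  also have "2 * real K * real T * real T * exp (- L) = 1 / real T"
    unfolding exp_L using KT by (simp add: power3_eq_cube)
  finally have prob_Bad: "real T * prob Bad \<le> 1" using KT by (simp add: field_simps)

  define R where "R \<omega> = (\<Sum>t\<in>{1..T}. g (sb_arm K T B (\<lambda>k t. X k t \<omega>) t) t)" for \<omega>
  define C where "C = 2 * b * real T + sqrt (2 * L) * sqrt (real K * real T * real Mseg) + real K * real Mseg"
  have b: "0 \<le> b" using T by (simp add: b_def le_max_iff_disj)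
  have C: "0 \<le> C" using b L by (simp add: C_def)
  \<comment> \<open>On \<open>Bad\<close> every step costs at most 1, hence at most \<open>T\<close>
    in all; weighted by \<open>prob Bad\<close> this becomes the final summand 1.\<close>
  have R_le: "R \<omega> \<le> C + real T * indicator Bad \<omega>" if \<omega>: "\<omega> \<in> space M" for \<omega>
  proof -
    interpret sb: selective_bandits K T B "\<lambda>k t. X k t \<omega>" by unfold_locales fact
    show ?thesis
    proof (cases "\<omega> \<in> Bad")
      case True
      have "R \<omega> \<le> (\<Sum>t\<in>{1..T}. 1)"
        unfolding R_def using gap01 sb.arm_range by (intro sum_mono) simp
      then show ?thesis using True C by simp
    next
      case False
      have conc: "\<bar>\<Sum>t\<in>sb.pulls k s u. X k t \<omega> + g k t\<bar> \<le> sqrt (real (card (sb.pulls k s u)) * L / 2)"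
        if ksu: "k \<in> {1..K}" "s \<in> {1..T}" "u \<le> T + 1" for k s u
      proof (cases "sb.pulls k s u = {}")
        case ne: False
        define n where "n = card (sb.pulls k s u)"
        have "sb.pulls k s u \<subseteq> {1..T}" using ksu by (auto simp: sb.pulls_def)
        then have "n \<le> card {1..T}" unfolding n_def by (rule card_mono[rotated]) simp
        moreover have "n \<noteq> 0" using ne by (simp add: n_def)
        ultimately have n: "n \<in> {1..T}" by auto
        have "\<sigma> * (\<Sum>t\<in>sb.pulls k s u. X k t \<omega> + g k t) \<le> sqrt (real n * L / 2)"
          if "\<sigma> \<in> {1, -1}" for \<sigma>
        proof -
          have "(\<sigma>, k, s, n) \<in> Q" using that ksu n by (simp add: Q_def)
          with False have "\<omega> \<notin> D (\<sigma>, k, s, n)" unfolding Bad_def by blast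
          then show ?thesis
            using \<omega> sb.first_pulls_eq[of s u T k] ksu
            by (simp add: D_def n_def[symmetric] sum_distrib_left not_less)
        qed
        from this[of 1] this[of "-1"] show ?thesis by (simp add: n_def[symmetric] abs_le_iff)
      qed simp
      interpret concentrated_bandits K T B "\<lambda>k t. X k t \<omega>" g L b
        by unfold_locales (use T gap01 conc in \<open>auto simp: L_def b_def\<close>)
      have "R \<omega> \<le> C"
        unfolding R_def C_def by (rule regret_bound[of seg]) (use seg seg_mono small in auto)
      then show ?thesis using False by simp
    qed
  qed
  have "expectation R \<le> C + 1"
  proof (cases "integrable M R")
    case True
    have int: "integrable M (\<lambda>\<omega>. real T * indicator Bad \<omega>)"
      using Bad by (intro integrable_mult_right integrable_real_indicator) (auto simp: less_top[symmetric])
    have "expectation R \<le> expectation (\<lambda>\<omega>. C + real T * indicator Bad \<omega>)"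
      using R_le int by (intro integral_mono True) auto
    also have "\<dots> = C + real T * prob Bad"
      using int by (subst Bochner_Integration.integral_add) (auto simp: prob_space)
    finally show ?thesis using prob_Bad by simp
  next
    \<comment> \<open>The integral of a non-integrable function is 0 by convention, so
      \<open>C\<close> being nonnegative settles this case and integrability of \<open>R\<close>
      need not be shown.\<close>
    case False
    then show ?thesis using C by (simp add: not_integrable_integral_eq)
  qed
  moreover have "C + 1 \<le> (2 powr (3/2) + 2 powr (1/2) * c * L) * sqrt (real K * real T * real Mseg)
      + 2 * real K * real Mseg + 8 * real T * b + 1"
  proof -
    have "sqrt (2 * L) * sqrt (real K * real T * real Mseg)
      \<le> (2 powr (3/2) + 2 powr (1/2) * c * L) * sqrt (real K * real T * real Mseg)"
      using L \<open>c \<ge> 16\<close> by (intro mult_right_mono sqrt_two_mult_le) auto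
    moreover have "2 * b * real T \<le> 8 * real T * b"
      using mult_nonneg_nonneg[of b "real T"] b by (simp add: mult_ac)
    moreover have "real K * real Mseg \<le> 2 * real K * real Mseg" by simp
    ultimately show ?thesis unfolding C_def by linarith
  qed
  ultimately show ?thesis
    unfolding R_def g_def L_def b_def by (simp add: max.commute)
qed

end
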